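(* Let $G$ be a connected finite simple graph, let $r$ be a vertex of $G$, and let $T$ be a bearing tree of $G$ rooted at $r$ such that any two distinct stems of $T$ intersect only in $r$. Then $G$ is geodetic if and only if every block of $G$ is transversal to $T$.
   Context: A geodesic is a shortest path between two vertices; $G$ is geodetic if between any two vertices there is exactly one geodesic. A bearing tree of $G$ rooted at $r$ is a spanning tree $T$ of $G$ obtained by breadth-first search from $r$; in particular $d_T(r,v)=d_G(r,v)$ for every vertex $v$. The $k$-th tier is the set of vertices at distance $k$ from $r$. A stem of $T$ is a path in $T$ from $r$ to a leaf of $T$. A balk is an edge of $G$ whose two endpoints lie in the same tier; a balk between stems $s$ and $s'$ in tier $j$ is a balk joining the tier-$j$ vertex of $s$ to the tier-$j$ vertex of $s'$. A subgraph $H$ of $G$ is transversal to $T$ if either $H$ is a connected subgraph of a single stem, or there are stems $s_0,\dots,s_n$ and natural numbers $l\le k$ such that $V(H)$ lies on $s_0,\dots,s_n$ and the edge set of $H$ consists exactly of: all edges of $s_0,\dots,s_n$ between $r$ and tier $k$ ($k$ edges on each stem); one balk in tier $k$ between $s_0$ and $s_i$ for each $i=1,\dots,n$; and one balk in tier $l$ between $s_i$ and $s_j$ for each $1\le i<j\le n$. A block is a maximal connected subgraph without a cut vertex. *)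

theory Defs
  imports "Graph_Theory.Graph_Theory"
begin

text \<open>
  Finite simple graphs are rendered by the locale \<^locale>\<open>pair_graph\<close> (finite, loopless, symmetric,
  no parallel arcs): an undirected edge is a pair of opposite arcs. A path is an \<open>apath\<close>, given by
  its list of arcs; its vertex list is computed by \<^const>\<open>pawalk_verts\<close>.
\<close>

definition edges :: "'a pair_pre_digraph \<Rightarrow> 'a set set" where
  "edges G = {{u, v} | u v. (u, v) \<in> parcs G}"

definition path_edges :: "('a \<times> 'a) awalk \<Rightarrow> 'a set set" where
  "path_edges p = {{u, v} | u v. (u, v) \<in> set p}"

definition geodesic :: "'a pair_pre_digraph \<Rightarrow> 'a \<Rightarrow> ('a \<times> 'a) awalk \<Rightarrow> 'a \<Rightarrow> bool" where
  "geodesic G u p v \<longleftrightarrow>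
     pre_digraph.apath G u p v \<and> (\<forall>q. pre_digraph.apath G u q v \<longrightarrow> length p \<le> length q)"

definition geodetic :: "'a pair_pre_digraph \<Rightarrow> bool" where
  "geodetic G \<longleftrightarrow> (\<forall>u \<in> pverts G. \<forall>v \<in> pverts G. \<exists>!p. geodesic G u p v)"

text \<open>Only meaningful if \<open>v\<close> is reachable from \<open>u\<close>.\<close>

definition gdist :: "'a pair_pre_digraph \<Rightarrow> 'a \<Rightarrow> 'a \<Rightarrow> nat" where
  "gdist G u v = (LEAST n. \<exists>p. pre_digraph.apath G u p v \<and> length p = n)"

definition tier :: "'a pair_pre_digraph \<Rightarrow> 'a \<Rightarrow> nat \<Rightarrow> 'a set" where
  "tier G r k = {v \<in> pverts G. gdist G r v = k}"

text \<open>
  The library's \<^const>\<open>tree\<close> forbids every directed cycle, in particular the closed walk \<open>u, v, u\<close>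
  along an edge of a symmetric digraph. For undirected graphs only cycles of length at least
  three count.
\<close>

definition undirected_tree :: "'a pair_pre_digraph \<Rightarrow> bool" where
  "undirected_tree T \<longleftrightarrow>
     pair_graph T \<and> connected T \<and> \<not> (\<exists>p. pre_digraph.cycle T p \<and> 3 \<le> length p)"

text \<open>
  The partial trees of a breadth-first search. The search proceeds level by level: all undiscovered
  neighbours of the discovered vertices are discovered next, each through an arbitrary
  discovered neighbour. No queue discipline within a level is imposed.
\<close>

inductive bfs_stage :: "'a pair_pre_digraph \<Rightarrow> 'a \<Rightarrow> 'a pair_pre_digraph \<Rightarrow> bool"
  for G :: "'a pair_pre_digraph" and r :: 'a where
  start: "bfs_stage G r \<lparr>pverts = {r}, parcs = {}\<rparr>"
| level: "bfs_stage G r \<lparr>pverts = W \<union> N, parcs = F \<union> {(par v, v) | v. v \<in> N} \<union> {(v, par v) | v. v \<in> N}\<rparr>"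
    if "bfs_stage G r \<lparr>pverts = W, parcs = F\<rparr>"
      and "N = {v \<in> pverts G - W. \<exists>u \<in> W. (u, v) \<in> parcs G}"
      and "\<forall>v \<in> N. par v \<in> W \<and> (par v, v) \<in> parcs G"

definition bearing_tree :: "'a pair_pre_digraph \<Rightarrow> 'a \<Rightarrow> 'a pair_pre_digraph \<Rightarrow> bool" where
  "bearing_tree G r T \<longleftrightarrow> undirected_tree T \<and> spanning T G \<and> bfs_stage G r T"

text \<open>
  A leaf of a rooted tree is a vertex without children, i.e. without a neighbour further from
  the root. So the root is a leaf only if it is the sole vertex.
\<close>

definition leaf :: "'a pair_pre_digraph \<Rightarrow> 'a \<Rightarrow> 'a \<Rightarrow> bool" where
  "leaf T r v \<longleftrightarrow> v \<in> pverts T \<and> \<not> (\<exists>w. (v, w) \<in> parcs T \<and> gdist T r v < gdist T r w)"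

definition stem :: "'a pair_pre_digraph \<Rightarrow> 'a \<Rightarrow> ('a \<times> 'a) awalk \<Rightarrow> bool" where
  "stem T r s \<longleftrightarrow> (\<exists>v. leaf T r v \<and> pre_digraph.apath T r s v)"

definition balk :: "'a pair_pre_digraph \<Rightarrow> 'a \<Rightarrow> 'a set \<Rightarrow> bool" where
  "balk G r e \<longleftrightarrow> e \<in> edges G \<and> (\<exists>j. e \<subseteq> tier G r j)"

definition balk_between ::
    "'a pair_pre_digraph \<Rightarrow> 'a \<Rightarrow> nat \<Rightarrow> ('a \<times> 'a) awalk \<Rightarrow> ('a \<times> 'a) awalk \<Rightarrow> 'a set \<Rightarrow> bool" where
  "balk_between G r j s s' e \<longleftrightarrow> balk G r e \<and>
     (\<exists>x y. e = {x, y} \<and> x \<in> set (pawalk_verts r s) \<inter> tier G r j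
                     \<and> y \<in> set (pawalk_verts r s') \<inter> tier G r j)"

definition edges_up_to ::
    "'a pair_pre_digraph \<Rightarrow> 'a \<Rightarrow> nat \<Rightarrow> ('a \<times> 'a) awalk \<Rightarrow> 'a set set" where
  "edges_up_to G r k s = {e \<in> path_edges s. e \<subseteq> (\<Union>j \<le> k. tier G r j)}"

definition transversal ::
    "'a pair_pre_digraph \<Rightarrow> 'a \<Rightarrow> 'a pair_pre_digraph \<Rightarrow> 'a pair_pre_digraph \<Rightarrow> bool" where
  "transversal G r T H \<longleftrightarrow> pair_graph H \<and> subgraph H G \<and>
     ((connected H \<and>
        (\<exists>s. stem T r s \<and> pverts H \<subseteq> set (pawalk_verts r s) \<and> edges H \<subseteq> path_edges s)) \<or>
      (\<exists>(n :: nat) (s :: nat \<Rightarrow> ('a \<times> 'a) awalk) l k b c.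
         (\<forall>i \<le> n. stem T r (s i)) \<and> l \<le> k \<and>
         pverts H \<subseteq> (\<Union>i \<le> n. set (pawalk_verts r (s i))) \<and>
         (\<forall>i \<le> n. card (edges_up_to G r k (s i)) = k) \<and>
         (\<forall>i \<in> {1..n}. balk_between G r k (s 0) (s i) (b i)) \<and>
         (\<forall>i j. 1 \<le> i \<and> i < j \<and> j \<le> n \<longrightarrow> balk_between G r l (s i) (s j) (c i j)) \<and>
         edges H = (\<Union>i \<le> n. edges_up_to G r k (s i))
                   \<union> {b i | i. 1 \<le> i \<and> i \<le> n}
                   \<union> {c i j | i j. 1 \<le> i \<and> i < j \<and> j \<le> n}))"

text \<open>A cut vertex separates two other vertices of its component.\<close>

definition cut_vertex :: "('a, 'b) pre_digraph \<Rightarrow> 'a \<Rightarrow> bool" where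
  "cut_vertex H v \<longleftrightarrow> v \<in> verts H \<and>
     (\<exists>x \<in> verts H - {v}. \<exists>y \<in> verts H - {v}.
        x \<rightarrow>\<^sup>*\<^bsub>H\<^esub> y \<and> \<not> x \<rightarrow>\<^sup>*\<^bsub>pre_digraph.del_vert H v\<^esub> y)"

definition block :: "'a pair_pre_digraph \<Rightarrow> 'a pair_pre_digraph \<Rightarrow> bool" where
  "block G B \<longleftrightarrow>
     pre_digraph.max_subgraph G (\<lambda>H. symmetric H \<and> connected H \<and> \<not> (\<exists>v. cut_vertex H v)) B"


text \<open>Distances are attained by paths and bounded by the lengths of walks.\<close>

lemma (in pair_wf_digraph) gdist_le:
  assumes "awalk u p v"
  shows "gdist G u v \<le> length p"
proof -
  let ?q = "awalk_to_apath p"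
  have q: "apath u ?q v" using assms by (rule apath_awalk_to_apath)
  then have "distinct ?q" by (auto simp: apath_def intro: distinct_verts_imp_distinct)
  then have "length ?q = card (set ?q)" by (simp add: distinct_card)
  also have "\<dots> \<le> card (set p)"
    using awalk_to_apath_subset[OF assms] by (simp add: card_mono)
  also have "\<dots> \<le> length p" by (rule card_length)
  finally have "length ?q \<le> length p" .
  moreover have "gdist G u v \<le> length ?q"
    unfolding gdist_def by (rule Least_le) (use q in auto)
  ultimately show ?thesis by simp
qed

lemma (in pair_wf_digraph) gdist_attained:
  assumes "awalk u p v"
  shows "\<exists>q. apath u q v \<and> length q = gdist G u v"
  unfolding gdist_def
  by (rule LeastI_ex) (use apath_awalk_to_apath[OF assms] in auto)

text \<open>The breadth-first search indeed preserves distances from the root.\<close>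

lemma (in pair_wf_digraph) bfs_stage_invariant:
  assumes "bfs_stage G r S" "r \<in> pverts G"
  shows "r \<in> pverts S \<and>
    (\<exists>n. \<forall>v. v \<in> pverts S \<longleftrightarrow> (\<exists>p. awalk r p v) \<and> gdist G r v \<le> n) \<and>
    (\<forall>v \<in> pverts S. \<exists>p. pre_digraph.awalk S r p v \<and> length p = gdist G r v)"
  using assms(1)
proof (induction S rule: bfs_stage.induct)
  case start
  have r: "awalk r [] r" using assms(2) by (simp add: awalk_def)
  have d: "gdist G r r = 0" using gdist_le[OF r] by simp
  have "v = r" if "awalk r p v" "gdist G r v = 0" for p v
    using gdist_attained[OF that(1)] that(2) by (auto simp: apath_def awalk_def)
  then have "\<forall>v. v \<in> {r} \<longleftrightarrow> (\<exists>p. awalk r p v) \<and> gdist G r v \<le> 0" using r d by auto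
  moreover have "pre_digraph.awalk (with_proj \<lparr>pverts = {r}, parcs = {}\<rparr>) r [] r"
    by (simp add: pre_digraph.awalk_def pre_digraph.cas.simps)
  ultimately show ?case using d by (intro conjI exI[of _ 0]) auto
next
  case (level W F N par)
  let ?S = "\<lparr>pverts = W, parcs = F\<rparr>"
  let ?S' = "\<lparr>pverts = W \<union> N, parcs = F \<union> {(par v, v) | v. v \<in> N} \<union> {(v, par v) | v. v \<in> N}\<rparr>"
  from level.IH obtain n where rW: "r \<in> W"
    and W: "\<And>v. v \<in> W \<longleftrightarrow> (\<exists>p. awalk r p v) \<and> gdist G r v \<le> n"
    and walks: "\<And>v. v \<in> W \<Longrightarrow> \<exists>p. pre_digraph.awalk ?S r p v \<and> length p = gdist G r v"
    by auto
  have ext: "awalk r (p @ [(u, v)]) v" if "awalk r p u" "(u, v) \<in> parcs G" for p u v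
    using that by (auto simp: awalk_append_iff awalk_simps in_arcsD1 in_arcsD2)
  have N: "(\<exists>p. awalk r p v) \<and> gdist G r v = Suc n \<and> gdist G r (par v) = n" if "v \<in> N" for v
  proof -
    have v: "par v \<in> W" "(par v, v) \<in> parcs G" "v \<notin> W" using that level.hyps by auto
    then obtain p where p: "awalk r p (par v)" using W by auto
    obtain q where q: "apath r q (par v)" "length q = gdist G r (par v)"
      using gdist_attained[OF p] by blast
    have w: "awalk r (q @ [(par v, v)]) v" using ext q(1) v(2) by (auto simp: apath_def)
    from gdist_le[OF w] have "gdist G r v \<le> Suc (gdist G r (par v))" using q by simp
    moreover have "gdist G r (par v) \<le> n" using v W by blast
    moreover have "gdist G r v > n" using v W w by (meson not_less)
    ultimately have "gdist G r v = Suc n \<and> gdist G r (par v) = n" by linarith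
    then show ?thesis using w by blast
  qed
  have "v \<in> W \<union> N \<longleftrightarrow> (\<exists>p. awalk r p v) \<and> gdist G r v \<le> Suc n" for v
  proof
    assume "v \<in> W \<union> N"
    then show "(\<exists>p. awalk r p v) \<and> gdist G r v \<le> Suc n" using W N le_SucI by fastforce
  next
    assume v: "(\<exists>p. awalk r p v) \<and> gdist G r v \<le> Suc n"
    show "v \<in> W \<union> N"
    proof (cases "v \<in> W")
      case False
      with v W have d: "gdist G r v = Suc n" by (metis le_SucE)
      obtain q where q: "awalk r q v" "length q = Suc n"
        using v d gdist_attained by (metis apath_def)
      then obtain q' e where q': "q = q' @ [e]" by (metis length_Suc_conv_rev)
      with q have "awalk r q' (fst e)" "e \<in> parcs G" "snd e = v"
        by (auto simp: awalk_append_iff awalk_simps)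
      moreover have "gdist G r (fst e) \<le> n" using gdist_le[OF calculation(1)] q q' by simp
      ultimately have "fst e \<in> W" "(fst e, v) \<in> parcs G" using W by auto
      then have "v \<in> N" using False level.hyps in_arcsD2 by auto
      then show ?thesis by simp
    qed simp
  qed
  moreover have "\<exists>p. pre_digraph.awalk ?S' r p v \<and> length p = gdist G r v" if "v \<in> W \<union> N" for v
  proof -
    have lift: "pre_digraph.awalk ?S' r p w" if "pre_digraph.awalk ?S r p w" for p w
      using that by (auto simp: pre_digraph.awalk_def cas_with_proj_eq)
    show ?thesis
    proof (cases "v \<in> W")
      case True
      then show ?thesis using walks lift by blast
    next
      case False
      with that have v: "v \<in> N" by simp
      then obtain p where p: "pre_digraph.awalk ?S r p (par v)" "length p = n"
        using walks N level.hyps by metis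
      have c: "pcas u (p @ [(w, v)]) v" if "pcas u p w" for u w
        using that by (induction u p w rule: pcas.induct) auto
      have "pre_digraph.awalk ?S' r (p @ [(par v, v)]) v"
        using lift[OF p(1)] v c by (auto simp: pre_digraph.awalk_def cas_with_proj_eq)
      then show ?thesis using p(2) N[OF v] by (intro exI[of _ "p @ [(par v, v)]"]) simp
    qed
  qed
  ultimately show ?case using rW by auto
qed

lemma bearing_tree_gdist:
  assumes "pair_graph G" "bearing_tree G r T" "v \<in> pverts G"
  shows "gdist T r v = gdist G r v"
proof -
  interpret G: pair_graph G by fact
  have T: "pair_graph T" "subgraph T G" "pverts T = pverts G" "bfs_stage G r T"
    using assms(2) by (auto simp: bearing_tree_def undirected_tree_def spanning_def)
  interpret T: pair_graph T by fact
  have "r \<in> pverts T" using T(4) by (induction rule: bfs_stage.induct) auto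
  with T(3) G.bfs_stage_invariant[OF T(4)] assms(3)
  obtain p where p: "T.awalk r p v" "length p = gdist G r v" by auto
  obtain q where q: "T.apath r q v" "length q = gdist T r v"
    using T.gdist_attained[OF p(1)] by blast
  have "G.awalk r q v"
    using q(1) T(2) by (auto simp: T.apath_def intro: G.subgraph_awalk_imp_awalk)
  from G.gdist_le[OF this] T.gdist_le[OF p(1)] p q show ?thesis by simp
qed

end

theory Submission
  imports Defs
begin

text \<open>
  Disjoint stems turn \<open>T\<close> into a spider whose legs are the stems. If \<open>G\<close> is geodetic, every other edge
  is a balk, and comparing pairs of different routes of equal length shows: two stems carry at most
  one balk, carrying a balk is transitive, the largest tier occurs twice among the balks of any three
  stems, and two stems have at most one common neighbour by balks above the tier of their own
  balk. Hence each class of stems linked by balks is a star: one hub, joined to all others in a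
  tier \<open>k\<close>, while the others are pairwise joined in a tier \<open>l \<le> k\<close>. Conversely, for such a
  spider the distance to a fixed vertex is given by an explicit formula, and every other vertex
  has exactly one neighbour that is closer: routes whose lengths have different parity cannot tie, and
  if the route through the root ties with a route along two balks, the route along one balk is shorter.

  A balk closes a cycle through the root, and the union of two connected subgraphs without cut vertices that
  share two vertices has no cut vertex. So a block with a balk contains the full cycles of all
  balks of a star, and nothing else, because the root and the tops of these cycles are cut vertices.
\<close>

section \<open>Unique geodesics in spiders\<close>

text \<open>Both directions meet in the condition \<open>starry\<close>, which mentions neither
  distances nor blocks: unique geodesics are compared with it inside the locale
  \<open>spider\<close>, transversality of all blocks inside the graph. A spider shows the graph
  only as a relation \<open>E\<close> on points \<open>pt i a\<close>, so a route is membership in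
  \<open>E ^^ n\<close> and nothing but its length matters. The obstacle is that nothing in the
  graph marks the hub. Seen from geodesics, the tier of the common balk is an ultrametric on a class
  of linked stems; excluding second apexes leaves the constant ultrametrics and those in which one
  point, the hub, has a larger value to all others. Seen from blocks, the hub is the stem numbered
  0. The converse makes no argument about individual routes. The explicit formula is shown to be a
  distance with unique descent by checking it edge by edge, which leaves integer arithmetic with
  parity.\<close>

text \<open>Routes of equal length that differ in their first step are never shortest. By induction on the
  length, this makes shortest walks unique.\<close>

definition unique_geodesics :: "'a rel \<Rightarrow> bool" where
  "unique_geodesics E \<longleftrightarrow> (\<forall>u w w' v n.
     (u, w) \<in> E \<and> (u, w') \<in> E \<and> w \<noteq> w' \<and> (w, v) \<in> E ^^ n \<and> (w', v) \<in> E ^^ n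
       \<longrightarrow> (\<exists>m \<le> n. (u, v) \<in> E ^^ m))"

lemma unique_geodesicsD:
  assumes "unique_geodesics E" "(u, w) \<in> E" "(u, w') \<in> E" "w \<noteq> w'"
    "(w, v) \<in> E ^^ n" "(w', v) \<in> E ^^ n"
  obtains m where "m \<le> n" "(u, v) \<in> E ^^ m"
  using assms unfolding unique_geodesics_def by blast

text \<open>Such a \<open>D\<close> is forced to be the distance: the Lipschitz bound makes it a
  lower bound for walk lengths (\<open>up\<close>), and descending steps realise it
  (\<open>walk\<close>). Two different first steps that both reach \<open>v\<close> in
  \<open>n\<close> steps while \<open>D u v > n\<close> would both be descents.\<close>

lemma unique_geodesicsI_distance:
  assumes D0: "\<And>v. D v v = (0 :: nat)"
    and lip: "\<And>u w v. (u, w) \<in> E \<Longrightarrow> v \<in> Field E \<Longrightarrow> D u v \<le> Suc (D w v)"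
    and desc: "\<And>u v. u \<in> Field E \<Longrightarrow> v \<in> Field E \<Longrightarrow> u \<noteq> v \<Longrightarrow> \<exists>w. (u, w) \<in> E \<and> D u v = Suc (D w v)"
    and unique: "\<And>u w w' v. (u, w) \<in> E \<Longrightarrow> (u, w') \<in> E \<Longrightarrow> v \<in> Field E \<Longrightarrow> u \<noteq> v \<Longrightarrow>
       D u v = Suc (D w v) \<Longrightarrow> D u v = Suc (D w' v) \<Longrightarrow> w = w'"
  shows "unique_geodesics E"
  unfolding unique_geodesics_def
proof (intro allI impI, elim conjE)
  fix u w w' v n
  assume h: "(u, w) \<in> E" "(u, w') \<in> E" "w \<noteq> w'" "(w, v) \<in> E ^^ n" "(w', v) \<in> E ^^ n"
  have vF: "v \<in> Field E"
  proof (cases n)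
    case 0
    then show ?thesis using h by (auto simp: Field_def)
  next
    case (Suc k)
    then show ?thesis using h(4) by (auto simp: Field_def)
  qed
  have up: "D x v \<le> m" if "(x, v) \<in> E ^^ m" for x m
    using that
  proof (induction m arbitrary: x)
    case 0
    then show ?case by (simp add: D0)
  next
    case (Suc m)
    then obtain y where y: "(x, y) \<in> E" "(y, v) \<in> E ^^ m" by (meson relpow_Suc_D2)
    then show ?case using lip[OF y(1) vF] Suc.IH[OF y(2)] by simp
  qed
  have walk: "(x, v) \<in> E ^^ m" if "x \<in> Field E" "D x v = m" for x m
    using that
  proof (induction m arbitrary: x)
    case 0
    have "x = v"
    proof (rule ccontr)
      assume "x \<noteq> v"
      then show False using desc[OF 0(1) vF] 0(2) by auto
    qed
    then show ?case by simp
  next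
    case (Suc m)
    then have "x \<noteq> v" using D0 by auto
    then obtain y where y: "(x, y) \<in> E" "D x v = Suc (D y v)" using desc[OF Suc.prems(1) vF] by auto
    then have "y \<in> Field E" by (auto simp: Field_def)
    then show ?case using y Suc by (metis old.nat.inject relpow_Suc_I2)
  qed
  have uF: "u \<in> Field E" using h by (auto simp: Field_def)
  show "\<exists>m \<le> n. (u, v) \<in> E ^^ m"
  proof (cases "u = v")
    case True
    then show ?thesis by (intro exI[of _ 0]) simp
  next
    case False
    have "D u v \<le> n"
    proof (rule ccontr)
      assume "\<not> D u v \<le> n"
      moreover have "D w v \<le> n" "D w' v \<le> n" using up h by auto
      moreover have "D u v \<le> Suc (D w v)" "D u v \<le> Suc (D w' v)" using lip h vF by auto
      ultimately have "D u v = Suc (D w v)" "D u v = Suc (D w' v)" by auto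
      then show False using unique[OF h(1,2) vF False] h(3) by blast
    qed
    then show ?thesis using walk[OF uF] by blast
  qed
qed

text \<open>What the geodesic argument needs, in coordinates: \<open>pt i a\<close> is the
  tier-\<open>a\<close> vertex of stem \<open>i\<close>. The stems share the root, so
  \<open>pt_inj\<close> asks for \<open>0 < a\<close>. \<open>E_tier\<close> says that an edge
  changes the tier by at most one; by symmetry of \<open>E\<close> one inequality suffices.\<close>

locale spider =
  fixes S :: "'s set" and len :: "'s \<Rightarrow> nat" and pt :: "'s \<Rightarrow> nat \<Rightarrow> 'a" and r :: 'a and E :: "'a rel"
  assumes finite_stems: "finite S"
    and pt_0: "i \<in> S \<Longrightarrow> pt i 0 = r"
    and pt_inj: "\<lbrakk>i \<in> S; j \<in> S; a \<le> len i; b \<le> len j; 0 < a; pt i a = pt j b\<rbrakk> \<Longrightarrow> i = j \<and> a = b"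
    and stem_edge: "\<lbrakk>i \<in> S; a < len i\<rbrakk> \<Longrightarrow> (pt i a, pt i (Suc a)) \<in> E"
    and E_sym: "(u, v) \<in> E \<Longrightarrow> (v, u) \<in> E"
    and E_irrefl: "(u, u) \<notin> E"
    and E_on_stem: "(u, v) \<in> E \<Longrightarrow> \<exists>i \<in> S. \<exists>a \<le> len i. u = pt i a"
    and E_tier: "\<lbrakk>i \<in> S; j \<in> S; a \<le> len i; b \<le> len j; (pt i a, pt j b) \<in> E\<rbrakk> \<Longrightarrow> b \<le> Suc a"
begin

definition balk_at :: "'s \<Rightarrow> 's \<Rightarrow> nat \<Rightarrow> bool" where
  "balk_at i j a \<longleftrightarrow> i \<in> S \<and> j \<in> S \<and> i \<noteq> j \<and> a \<le> len i \<and> a \<le> len j \<and> (pt i a, pt j a) \<in> E"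

definition no_oblique :: bool where
  "no_oblique \<longleftrightarrow> (\<forall>i \<in> S. \<forall>j \<in> S. \<forall>a b. 0 < a \<longrightarrow> a \<le> len i \<longrightarrow> 0 < b \<longrightarrow> b \<le> len j \<longrightarrow> i \<noteq> j
      \<longrightarrow> (pt i a, pt j b) \<in> E \<longrightarrow> a = b)"

text \<open>The equivalence also closes \<open>C\<close>: no member has a balk to a stem outside. A
  stem without balks forms a singleton star, where \<open>k\<close> and \<open>l\<close> are
  vacuous.\<close>

definition star :: "'s set \<Rightarrow> 's \<Rightarrow> nat \<Rightarrow> nat \<Rightarrow> bool" where
  "star C h k l \<longleftrightarrow> C \<subseteq> S \<and> h \<in> C \<and> l \<le> k \<and>
     (\<forall>i \<in> C. \<forall>m a. balk_at i m a \<longleftrightarrow> m \<in> C \<and> i \<noteq> m \<and> a = (if i = h \<or> m = h then k else l))"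

definition starry :: bool where
  "starry \<longleftrightarrow> no_oblique \<and> (\<forall>j \<in> S. \<exists>C h k l. j \<in> C \<and> star C h k l)"

lemma balk_at_sym: "balk_at i j a \<Longrightarrow> balk_at j i a"
  unfolding balk_at_def using E_sym by blast

lemma balk_at_pos: "balk_at i j a \<Longrightarrow> 0 < a"
  unfolding balk_at_def using pt_0 E_irrefl by (metis gr0I)

lemma pt_eq_iff:
  assumes "i \<in> S" "j \<in> S" "a \<le> len i" "b \<le> len j"
  shows "pt i a = pt j b \<longleftrightarrow> a = b \<and> (i = j \<or> a = 0)"
  using assms pt_inj[of i j a b] pt_inj[of j i b a] pt_0 by (metis gr0I)

lemma stem_walk_up:
  assumes "i \<in> S" "a \<le> b" "b \<le> len i"
  shows "(pt i a, pt i b) \<in> E ^^ (b - a)"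
  using assms(2,3)
proof (induction b)
  case (Suc b)
  show ?case
  proof (cases "a = Suc b")
    case False
    with Suc have "(pt i a, pt i b) \<in> E ^^ (b - a)" "(pt i b, pt i (Suc b)) \<in> E"
      using stem_edge[OF assms(1)] by auto
    then show ?thesis using False Suc.prems
      by (metis Suc_diff_le le_SucE relpow_Suc_I)
  qed simp
qed simp

lemma walk_sym: "(u, v) \<in> E ^^ n \<Longrightarrow> (v, u) \<in> E ^^ n"
proof (induction n arbitrary: v)
  case (Suc n)
  then obtain w where "(u, w) \<in> E ^^ n" "(w, v) \<in> E" by auto
  then show ?case using Suc.IH E_sym by (meson relpow_Suc_I2)
qed auto

lemma stem_walk_down:
  assumes "i \<in> S" "a \<le> b" "b \<le> len i"
  shows "(pt i b, pt i a) \<in> E ^^ (b - a)"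
  using stem_walk_up[OF assms] walk_sym by blast

lemma walk_append: "(u, v) \<in> E ^^ m \<Longrightarrow> (v, w) \<in> E ^^ n \<Longrightarrow> (u, w) \<in> E ^^ (m + n)"
  by (auto simp: relpow_add)

lemma walk_tier:
  assumes "i \<in> S" "j \<in> S" "a \<le> len i" "b \<le> len j" "(pt i a, pt j b) \<in> E ^^ n"
  shows "b \<le> a + n" "a \<le> b + n"
proof -
  have *: "b \<le> a + n" if "i \<in> S" "j \<in> S" "a \<le> len i" "b \<le> len j" "(pt i a, pt j b) \<in> E ^^ n"
    for i j a b using that
  proof (induction n arbitrary: i a)
    case 0
    then show ?case using pt_eq_iff by simp
  next
    case (Suc n)
    then obtain w where w: "(pt i a, w) \<in> E" "(w, pt j b) \<in> E ^^ n" by (meson relpow_Suc_D2)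
    then obtain m c where m: "m \<in> S" "c \<le> len m" "w = pt m c" using E_on_stem E_sym by meson
    then have "b \<le> c + n" "c \<le> Suc a" using Suc E_tier w by auto
    then show ?case by simp
  qed
  show "b \<le> a + n" using * assms by blast
  show "a \<le> b + n" using *[OF assms(2,1,4,3) walk_sym[OF assms(5)]] .
qed

lemma root_neighbour:
  assumes "(r, w) \<in> E" "S \<noteq> {}"
  obtains m where "m \<in> S" "1 \<le> len m" "w = pt m 1"
proof -
  obtain m c where m: "m \<in> S" "c \<le> len m" "w = pt m c" using E_on_stem E_sym assms by meson
  have "c \<noteq> 0" using m assms E_irrefl pt_0 by metis
  moreover have "c \<le> Suc 0" using E_tier[of m m 0 c] m assms pt_0 by simp
  ultimately show ?thesis using m that by (auto simp: le_Suc_eq)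
qed

lemma neighbour_cases:
  assumes "no_oblique" "i \<in> S" "0 < a" "a \<le> len i" "(pt i a, w) \<in> E"
  obtains (down) "w = pt i (a - 1)" | (up) "a < len i" "w = pt i (Suc a)"
    | (balk) m where "balk_at i m a" "w = pt m a"
proof -
  obtain m c where m: "m \<in> S" "c \<le> len m" "w = pt m c" using E_on_stem E_sym assms by meson
  have c: "c \<le> Suc a" "a \<le> Suc c" using E_tier m assms E_sym by blast+
  consider "c = 0" | "0 < c" "m = i" | "0 < c" "m \<noteq> i" by auto
  then show ?thesis
  proof cases
    \<comment> \<open>The root lies on every stem, so an edge to it counts as the downward edge of
      \<open>i\<close>.\<close>
    case 1
    then have "a = 1" using c assms by simp
    then show ?thesis using 1 m assms pt_0 down by simp
  next
    case 2
    then have "a \<noteq> c" using m assms E_irrefl by metis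
    then consider "c = a - 1" | "c = Suc a" using c by linarith
    then show ?thesis using 2 m down up by cases auto
  next
    case 3
    then have "a = c" using assms m unfolding no_oblique_def by blast
    then show ?thesis using balk[of m] 3 m assms unfolding balk_at_def by simp
  qed
qed

text \<open>Descending \<open>a - b\<close> tiers in at most that many steps leaves none to spare,
  so every step goes down. Without oblique edges this stays on \<open>i\<close>, and
  \<open>0 < b\<close> keeps the walk away from the root, where stems could be changed.\<close>

lemma steep_walk_same_stem:
  assumes "no_oblique" "i \<in> S" "j \<in> S" "a \<le> len i" "0 < b" "b \<le> len j"
    "(pt i a, pt j b) \<in> E ^^ n" "n + b \<le> a"
  shows "i = j"
  using assms(2,4,7,8)
proof (induction n arbitrary: i a)
  case 0
  then show ?case using assms pt_inj[of i j a b] by simp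
next
  case (Suc n)
  then obtain w where w: "(pt i a, w) \<in> E" "(w, pt j b) \<in> E ^^ n" by (meson relpow_Suc_D2)
  have "0 < a" using Suc.prems by simp
  from assms(1) Suc.prems(1) this Suc.prems(2) w(1) show ?case
  proof (cases rule: neighbour_cases)
    case down
    then show ?thesis using Suc.IH[of i "a - 1"] Suc.prems w(2) by simp
  next
    case up
    then show ?thesis using walk_tier(2)[of i j "Suc a" b n] Suc.prems w assms by simp
  next
    case (balk m)
    then show ?thesis using walk_tier(2)[of m j a b n] Suc.prems w assms by (simp add: balk_at_def)
  qed
qed

text \<open>There is one spare step. An upward step would cost two, so besides downward steps at
  most one balk fits in; since the stem changes away from the root, this balk joins precisely
  \<open>i\<close> and \<open>j\<close>.\<close>

lemma almost_steep_walk_balk: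
  assumes "no_oblique" "i \<in> S" "j \<in> S" "i \<noteq> j" "a \<le> len i" "0 < b" "b \<le> a" "b \<le> len j"
    "(pt i a, pt j b) \<in> E ^^ n" "n + b \<le> Suc a"
  shows "\<exists>t. b \<le> t \<and> t \<le> a \<and> balk_at i j t"
  using assms(5,7,9,10)
proof (induction n arbitrary: a)
  case 0
  then show ?case using assms pt_inj[of i j a b] by simp
next
  case (Suc n)
  then obtain w where w: "(pt i a, w) \<in> E" "(w, pt j b) \<in> E ^^ n" by (meson relpow_Suc_D2)
  have "0 < a" using Suc.prems assms by simp
  from assms(1,2) this Suc.prems(1) w(1) show ?case
  proof (cases rule: neighbour_cases)
    case down
    show ?thesis
    proof (cases "b \<le> a - 1")
      case True
      then have "\<exists>t\<ge>b. t \<le> a - 1 \<and> balk_at i j t" using Suc.IH[of "a - 1"] Suc.prems w down by simp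
      then show ?thesis by (meson diff_le_self le_trans)
    next
      case False
      then show ?thesis using walk_tier(1)[of i j "a - 1" b n] Suc.prems w assms down by simp
    qed
  next
    case up
    then show ?thesis using walk_tier(2)[of i j "Suc a" b n] Suc.prems w assms by simp
  next
    case (balk m)
    then have "m = j" using steep_walk_same_stem[of m j a b n] Suc.prems w assms by (simp add: balk_at_def)
    then show ?thesis using balk Suc.prems by blast
  qed
qed

section \<open>Constraints that unique geodesics impose on balks\<close>

lemma no_oblique_if_unique_geodesics:
  assumes ug: "unique_geodesics E"
  shows "no_oblique"
proof -
  \<comment> \<open>An oblique edge gives the vertex in tier \<open>a + 1\<close> of
    \<open>j\<close> two neighbours in tier \<open>a\<close>, hence two routes to the root of the
    least possible length \<open>a + 1\<close>.\<close>
  have *: False if h: "i \<in> S" "j \<in> S" "0 < a" "Suc a \<le> len j" "a \<le> len i" "i \<noteq> j"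
    "(pt j (Suc a), pt i a) \<in> E" for i j a
  proof -
    have "(pt j (Suc a), pt j a) \<in> E" using stem_edge[of j a] E_sym h by simp
    moreover have "pt i a \<noteq> pt j a" using h pt_inj[of i j a a] by auto
    moreover have "(pt i a, r) \<in> E ^^ a" "(pt j a, r) \<in> E ^^ a"
      using stem_walk_down[of i 0 a] stem_walk_down[of j 0 a] h pt_0 by auto
    ultimately obtain m where m: "m \<le> a" "(pt j (Suc a), r) \<in> E ^^ m"
      using unique_geodesicsD[OF ug h(7)] by metis
    then show False using walk_tier(2)[of j j "Suc a" 0 m] h pt_0 by simp
  qed
  show ?thesis unfolding no_oblique_def
  proof (intro ballI allI impI)
    fix i j a b
    assume h: "i \<in> S" "j \<in> S" "0 < a" "a \<le> len i" "0 < b" "b \<le> len j" "i \<noteq> j" "(pt i a, pt j b) \<in> E"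
    have "b \<le> Suc a" "a \<le> Suc b" using h E_tier E_sym by blast+
    moreover have "b \<noteq> Suc a" using *[of i j a] h E_sym by blast
    moreover have "a \<noteq> Suc b" using *[of j i b] h by blast
    ultimately show "a = b" by simp
  qed
qed

text \<open>For balks in tiers \<open>a < b\<close>, two routes of length \<open>b - a + 1\<close>
  lead from \<open>pt i a\<close> to \<open>pt j b\<close>: one crosses first, the other crosses
  last. A shorter route would be too steep to change stems.\<close>

lemma balk_at_unique:
  assumes ug: "unique_geodesics E" and balk_at: "balk_at i j a" "balk_at i j b"
  shows "a = b"
proof -
  note no = no_oblique_if_unique_geodesics[OF ug]
  have *: False if balk_at: "balk_at i j a" "balk_at i j b" and less: "a < b" for a b
  proof -
    from balk_at have h: "i \<in> S" "j \<in> S" "i \<noteq> j" "b \<le> len i" "b \<le> len j" "0 < a"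
      "(pt i a, pt j a) \<in> E" "(pt i b, pt j b) \<in> E" using balk_at_pos by (auto simp: balk_at_def)
    have 1: "(pt i a, pt i (Suc a)) \<in> E" "pt j a \<noteq> pt i (Suc a)"
      using stem_edge h less pt_inj[of j i a "Suc a"] by auto
    have 2: "(pt j a, pt j b) \<in> E ^^ (b - a)" using stem_walk_up h less by simp
    have "(pt i (Suc a), pt i b) \<in> E ^^ (b - Suc a)" using stem_walk_up[of i "Suc a" b] h less by simp
    then have "(pt i (Suc a), pt j b) \<in> E ^^ (Suc (b - Suc a))" using h by (meson relpow_Suc_I)
    moreover have "Suc (b - Suc a) = b - a" using less by simp
    ultimately obtain m where m: "m \<le> b - a" "(pt i a, pt j b) \<in> E ^^ m"
      using unique_geodesicsD[OF ug h(7) 1 2] by metis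
    from walk_sym[OF m(2)] have "j = i"
      using steep_walk_same_stem[OF no h(2,1,5,6), of m] m h less by linarith
    then show False using h by simp
  qed
  show ?thesis using *[OF balk_at] *[OF balk_at(2,1)] by (meson linorder_neqE_nat)
qed

text \<open>Compares the two ways from the tier-\<open>q\<close> vertex of \<open>m\<close> to the first vertex of \<open>i\<close>: through the
  root, and through \<open>j\<close>. Both have length \<open>q + 1\<close>.\<close>

lemma balk_at_trans_le:
  assumes ug: "unique_geodesics E" and balk_at: "balk_at i j p" "balk_at j m q" and ne: "i \<noteq> m" and le: "p \<le> q"
  shows "\<exists>t \<le> q. balk_at i m t"
proof -
  note no = no_oblique_if_unique_geodesics[OF ug]
  from balk_at have h: "i \<in> S" "j \<in> S" "m \<in> S" "i \<noteq> j" "j \<noteq> m" "p \<le> len i" "p \<le> len j" "q \<le> len j"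
    "q \<le> len m" "0 < p" "0 < q" "(pt j p, pt i p) \<in> E" "(pt m q, pt j q) \<in> E"
    using balk_at_pos E_sym by (auto simp: balk_at_def)
  have down: "(pt m q, pt m (q - 1)) \<in> E" using stem_edge[of m "q - 1"] h E_sym by simp
  have ne': "pt j q \<noteq> pt m (q - 1)" using h pt_inj[of j m q "q - 1"] by (auto dest: le_trans[OF diff_le_self])
  have "(pt m (q - 1), r) \<in> E ^^ (q - 1)" using stem_walk_down[of m 0 "q - 1"] h pt_0 by simp
  moreover have "(r, pt i 1) \<in> E" using stem_edge[of i 0] h pt_0 by simp
  ultimately have w1: "(pt m (q - 1), pt i 1) \<in> E ^^ q"
    using h by (metis One_nat_def Suc_pred relpow_Suc_I)
  have "(pt j q, pt j p) \<in> E ^^ (q - p)" using stem_walk_down h le by simp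
  then have "(pt j q, pt i p) \<in> E ^^ Suc (q - p)" using h by (meson relpow_Suc_I)
  moreover have "(pt i p, pt i 1) \<in> E ^^ (p - 1)" using stem_walk_down[of i 1 p] h by simp
  ultimately have "(pt j q, pt i 1) \<in> E ^^ (Suc (q - p) + (p - 1))" by (rule walk_append)
  moreover have "Suc (q - p) + (p - 1) = q" using h le by simp
  ultimately have w2: "(pt j q, pt i 1) \<in> E ^^ q" by simp
  obtain t where t: "t \<le> q" "(pt m q, pt i 1) \<in> E ^^ t"
    using unique_geodesicsD[OF ug h(13) down ne' w2 w1] by metis
  \<comment> \<open>Since \<open>t \<le> q\<close>, the descent from tier \<open>q\<close> to tier 1
    has at most one spare step, so it crosses by a single balk between \<open>m\<close> and
    \<open>i\<close>.\<close>
  have "\<exists>s\<ge>1. s \<le> q \<and> balk_at m i s"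
    by (rule almost_steep_walk_balk[OF no h(3,1) _ h(9) _ _ _ t(2)]) (use h ne t in auto)
  then show ?thesis using balk_at_sym by blast
qed

lemma balk_at_trans:
  assumes ug: "unique_geodesics E" and balk_at: "balk_at i j p" "balk_at j m q" and ne: "i \<noteq> m"
  shows "\<exists>t \<le> max p q. balk_at i m t"
proof (cases "p \<le> q")
  case True
  then show ?thesis using balk_at_trans_le[OF ug balk_at ne] by (simp add: max_def)
next
  case False
  then have "\<exists>t \<le> p. balk_at m i t" using balk_at_trans_le[OF ug balk_at_sym[OF balk_at(2)] balk_at_sym[OF balk_at(1)]] ne by auto
  then show ?thesis using balk_at_sym by (metis max.coboundedI1)
qed

text \<open>Applied to all arrangements of three stems, this is the ultrametric inequality for the
  tier of the common balk.\<close>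

lemma balk_at_triangle:
  assumes ug: "unique_geodesics E" and balk_at: "balk_at i j p" "balk_at j m q" "balk_at i m t"
  shows "t \<le> max p q"
  using balk_at_trans[OF ug balk_at(1,2)] balk_at_unique[OF ug balk_at(3)] balk_at(3) unfolding balk_at_def by blast

text \<open>If \<open>x\<close> and \<open>y\<close> both carry balks to \<open>u\<close> and \<open>v\<close>, then the tier-\<open>q\<close> vertex of \<open>x\<close> reaches the
  tier-\<open>p\<close> vertex of \<open>y\<close> through \<open>v\<close> and through \<open>u\<close> in \<open>p - q + 2\<close> steps.\<close>

lemma no_second_apex:
  assumes ug: "unique_geodesics E" and balk_at: "balk_at x u p" "balk_at y u p" "balk_at x v q" "balk_at y v q" "balk_at x y l"
    and ne: "u \<noteq> v" and le: "q \<le> p" and less: "l < q"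
  shows False
proof -
  note no = no_oblique_if_unique_geodesics[OF ug]
  from balk_at have h: "x \<in> S" "y \<in> S" "u \<in> S" "v \<in> S" "x \<noteq> y" "x \<noteq> u" "x \<noteq> v" "y \<noteq> u" "y \<noteq> v"
    "p \<le> len x" "p \<le> len y" "p \<le> len u" "q \<le> len v" "q \<le> len x" "q \<le> len y" "0 < q" "0 < p"
    "(pt x p, pt u p) \<in> E" "(pt u p, pt y p) \<in> E" "(pt x q, pt v q) \<in> E" "(pt v q, pt y q) \<in> E"
    using balk_at_pos E_sym by (auto simp: balk_at_def)
  have 1: "(pt v q, pt y p) \<in> E ^^ Suc (p - q)"
    using stem_walk_up[of y q p] h le by (meson relpow_Suc_I2)
  \<comment> \<open>The rival of the first step along the balk to \<open>v\<close>: up the stem of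
    \<open>x\<close> towards the balk to \<open>u\<close>, or that balk itself if
    \<open>q = p\<close>.\<close>
  have "\<exists>w. (pt x q, w) \<in> E \<and> w \<noteq> pt v q \<and> (w, pt y p) \<in> E ^^ Suc (p - q)"
  proof (cases "q = p")
    case True
    have "pt u p \<noteq> pt v q" using True h ne pt_inj[of u v p p] by auto
    then show ?thesis using True h by (intro exI[of _ "pt u p"]) auto
  next
    case False
    then have "pt x (Suc q) \<noteq> pt v q" using h pt_inj[of v x q "Suc q"] le by auto
    moreover have "(pt x (Suc q), pt x p) \<in> E ^^ (p - Suc q)"
      using stem_walk_up[of x "Suc q" p] h le False by simp
    then have "(pt x (Suc q), pt y p) \<in> E ^^ Suc (Suc (p - Suc q))"
      using h by (meson relpow_Suc_I)
    then have "(pt x (Suc q), pt y p) \<in> E ^^ Suc (p - q)"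
      using le False by (simp add: Suc_diff_Suc)
    ultimately show ?thesis using stem_edge[of x q] h le False by auto
  qed
  then obtain w where w: "(pt x q, w) \<in> E" "w \<noteq> pt v q" "(w, pt y p) \<in> E ^^ Suc (p - q)" by blast
  obtain n where n: "n \<le> Suc (p - q)" "(pt x q, pt y p) \<in> E ^^ n"
    using unique_geodesicsD[OF ug w(1) h(20) w(2,3) 1] by metis
  \<comment> \<open>Read backwards, the walk descends \<open>p - q\<close> tiers with at most one
    spare step, so \<open>x\<close> and \<open>y\<close> have a balk in tier \<open>q\<close> or
    above; but their only balk lies in tier \<open>l < q\<close>.\<close>
  from walk_sym[OF n(2)] have "\<exists>t\<ge>q. t \<le> p \<and> balk_at y x t"
    by (rule almost_steep_walk_balk[OF no h(2,1), rotated -2]) (use h le n in auto)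
  then show False using balk_at_unique[OF ug balk_at(5)] balk_at_sym less by fastforce
qed

text \<open>\<open>lam\<close> is an ultrametric on the class \<open>C\<close> of stems linked to
  \<open>j\<close>. If it is constant, any stem serves as hub with \<open>k = l\<close>. Otherwise
  some triangle has two equal longer sides; the stem where they meet is the hub, and
  \<open>apex\<close> forces every other stem into the same pattern.\<close>

lemma star_if_unique_geodesics:
  assumes ug: "unique_geodesics E" and j: "j \<in> S"
  shows "\<exists>C h k l. j \<in> C \<and> star C h k l"
proof -
  define C where "C = insert j {m. \<exists>a. balk_at j m a}"
  define lam where "lam i m = (THE a. balk_at i m a)" for i m
  have lam: "lam i m = a" if "balk_at i m a" for i m a
    unfolding lam_def using that balk_at_unique[OF ug] by blast
  have jC: "j \<in> C" and CS: "C \<subseteq> S" using j by (auto simp: C_def balk_at_def)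
  have to_j: "\<exists>a. balk_at i j a" if "i \<in> C" "i \<noteq> j" for i
    using that balk_at_sym unfolding C_def by blast
  have "\<exists>a. balk_at i m a" if "i \<in> C" "m \<in> C" "i \<noteq> m" for i m
    using that to_j[of i] to_j[of m] balk_at_sym balk_at_trans[OF ug] by metis
  then have balk_at_lam: "balk_at i m (lam i m)" if "i \<in> C" "m \<in> C" "i \<noteq> m" for i m
    using that lam by metis
  have closed: "m \<in> C" if "i \<in> C" "balk_at i m a" for i m a
  proof (cases "i = j \<or> m = j")
    case False
    then show ?thesis using that to_j[of i] balk_at_sym balk_at_trans[OF ug] unfolding C_def
      by (metis insertCI mem_Collect_eq)
  qed (use that jC in \<open>auto simp: C_def\<close>)
  have lam_sym: "lam i m = lam m i" if "i \<in> C" "m \<in> C" "i \<noteq> m" for i m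
    using lam[OF balk_at_sym[OF balk_at_lam]] that by metis
  have tri: "lam x z \<le> max (lam x y) (lam y z)"
    if "x \<in> C" "y \<in> C" "z \<in> C" "x \<noteq> y" "y \<noteq> z" "x \<noteq> z" for x y z
    using balk_at_triangle[OF ug balk_at_lam balk_at_lam balk_at_lam] that by blast
  have apex: False
    if "x \<in> C" "y \<in> C" "u \<in> C" "v \<in> C" "x \<noteq> y" "x \<noteq> u" "x \<noteq> v" "y \<noteq> u" "y \<noteq> v" "u \<noteq> v"
      "lam x u = lam y u" "lam x v = lam y v" "lam x y < lam x u" "lam x y < lam x v" for x y u v
  proof (cases "lam x v \<le> lam x u")
    case True
    from balk_at_lam[of x u] balk_at_lam[of y u] balk_at_lam[of x v] balk_at_lam[of y v] balk_at_lam[of x y]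
    show False using no_second_apex[OF ug, of x u "lam x u" y v "lam x v" "lam x y"] that True by auto
  next
    case False
    from balk_at_lam[of x u] balk_at_lam[of y u] balk_at_lam[of x v] balk_at_lam[of y v] balk_at_lam[of x y]
    show False using no_second_apex[OF ug, of x v "lam x v" y u "lam x u" "lam x y"] that False by auto
  qed
  have star: "star C h k l" if hl: "h \<in> C" "l \<le> k"
    and val: "\<And>i m. i \<in> C \<Longrightarrow> m \<in> C \<Longrightarrow> i \<noteq> m \<Longrightarrow> lam i m = (if i = h \<or> m = h then k else l)" for h k l
  proof -
    have "balk_at i m a \<longleftrightarrow> m \<in> C \<and> i \<noteq> m \<and> a = (if i = h \<or> m = h then k else l)" if "i \<in> C" for i m a
    proof
      assume b: "balk_at i m a"
      then have "m \<in> C" "i \<noteq> m" using closed that by (auto simp: balk_at_def)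
      then show "m \<in> C \<and> i \<noteq> m \<and> a = (if i = h \<or> m = h then k else l)"
        using lam[OF b] val[OF that \<open>m \<in> C\<close> \<open>i \<noteq> m\<close>] by simp
    next
      assume b: "m \<in> C \<and> i \<noteq> m \<and> a = (if i = h \<or> m = h then k else l)"
      then have "a = lam i m" using val[of i m] that by simp
      then show "balk_at i m a" using balk_at_lam b that by simp
    qed
    then show ?thesis unfolding star_def using hl CS by blast
  qed
  show ?thesis
  proof (cases "\<forall>x \<in> C. \<forall>y \<in> C. \<forall>z \<in> C. x \<noteq> y \<longrightarrow> y \<noteq> z \<longrightarrow> x \<noteq> z \<longrightarrow> lam x y = lam y z")
    case True
    have "\<exists>k. \<forall>i \<in> C. \<forall>m \<in> C. i \<noteq> m \<longrightarrow> lam i m = k"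
    proof (cases "C = {j}")
      case False
      then obtain n where n: "n \<in> C" "n \<noteq> j" using jC by blast
      have 1: "lam j m = lam j n" if "m \<in> C" "m \<noteq> j" for m
        using True that n jC lam_sym by metis
      have "lam i m = lam j n" if "i \<in> C" "m \<in> C" "i \<noteq> m" for i m
        using True that jC lam_sym 1 by metis
      then show ?thesis by blast
    qed auto
    then obtain k where "\<forall>i \<in> C. \<forall>m \<in> C. i \<noteq> m \<longrightarrow> lam i m = k" by blast
    then have "star C j k k" using star[of j k k] jC by simp
    then show ?thesis using jC by blast
  next
    case False
    then obtain x y z where xyz: "x \<in> C" "y \<in> C" "z \<in> C" "x \<noteq> y" "y \<noteq> z" "x \<noteq> z" "lam x y \<noteq> lam y z"
      by blast
    have "\<exists>h u v. h \<in> C \<and> u \<in> C \<and> v \<in> C \<and> h \<noteq> u \<and> h \<noteq> v \<and> u \<noteq> v \<and> lam h u = lam h v \<and> lam u v < lam h u"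
    proof -
      have t: "lam x z \<le> max (lam x y) (lam y z)" "lam x y \<le> max (lam x z) (lam y z)"
        "lam y z \<le> max (lam x y) (lam x z)"
        using tri[of x y z] tri[of x z y] tri[of y x z] xyz lam_sym by metis+
      show ?thesis
      proof (cases "lam x y < lam y z")
        case True
        then have "lam z x = lam z y" "lam x y < lam z x" 
          using t lam_sym[of x z] lam_sym[of y z] xyz by (auto simp: max_def split: if_splits)
        then show ?thesis using xyz by metis
      next
        case False
        then have "lam x y = lam x z" "lam y z < lam x y" using t xyz by (auto simp: max_def split: if_splits)
        then show ?thesis using xyz by metis
      qed
    qed
    then obtain h u v where huv: "h \<in> C" "u \<in> C" "v \<in> C" "h \<noteq> u" "h \<noteq> v" "u \<noteq> v" "lam h u = lam h v" "lam u v < lam h u"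
      by blast
    \<comment> \<open>Stated for arbitrary \<open>h\<close>, \<open>u\<close>, \<open>v\<close>
      because another base is needed later. If \<open>u m\<close> and \<open>v m\<close> lay above
      \<open>u v\<close>, then \<open>m\<close> would be a second apex over the base
      \<open>u v\<close>. If \<open>u m\<close> lay below \<open>u v\<close>, then \<open>h\<close>
      and \<open>v\<close> would be two apexes over the base \<open>u m\<close>; likewise for
      \<open>v m\<close>.\<close>
    have fourth: "lam h m = lam h u \<and> lam u m = lam u v \<and> lam v m = lam u v"
      if "h \<in> C" "u \<in> C" "v \<in> C" "h \<noteq> u" "h \<noteq> v" "u \<noteq> v" "lam h u = lam h v" "lam u v < lam h u"
        "m \<in> C" "m \<noteq> h" "m \<noteq> u" "m \<noteq> v" for h u v m
    proof -
      note s = lam_sym[OF \<open>h \<in> C\<close> \<open>m \<in> C\<close>] lam_sym[OF \<open>u \<in> C\<close> \<open>m \<in> C\<close>] lam_sym[OF \<open>v \<in> C\<close> \<open>m \<in> C\<close>]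
        lam_sym[OF \<open>u \<in> C\<close> \<open>v \<in> C\<close>] lam_sym[OF \<open>h \<in> C\<close> \<open>v \<in> C\<close>] lam_sym[OF \<open>h \<in> C\<close> \<open>u \<in> C\<close>]
      have t: "lam u m \<le> max (lam u v) (lam v m)" "lam v m \<le> max (lam u v) (lam u m)"
        "lam u v \<le> max (lam u m) (lam v m)" "lam h m \<le> max (lam h u) (lam u m)" "lam h u \<le> max (lam h m) (lam u m)"
        "lam h v \<le> max (lam h m) (lam v m)" "lam h m \<le> max (lam h v) (lam v m)"
        using tri[of u v m] tri[of v u m] tri[of u m v] tri[of h u m] tri[of h m u] tri[of h m v] tri[of h v m] that s by auto
      have 1: "lam u m \<le> lam u v \<and> lam v m \<le> lam u v"
      proof (rule ccontr)
        assume "\<not> ?thesis"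
        then have "lam u m = lam v m" "lam u v < lam u m" using t by (auto simp: max_def split: if_splits)
        then show False using apex[of u v h m] that s by auto
      qed
      then have 2: "lam h m = lam h u" using t that by (auto simp: max_def split: if_splits)
      have "\<not> lam u m < lam u v"
      proof
        assume a: "lam u m < lam u v"
        then have "lam v m = lam u v" using t 1 by (auto simp: max_def split: if_splits)
        then show False using apex[of u m h v] that s 2 a by auto
      qed
      moreover have "\<not> lam v m < lam u v"
      proof
        assume a: "lam v m < lam u v"
        then have "lam u m = lam u v" using t 1 by (auto simp: max_def split: if_splits)
        then show False using apex[of v m h u] that s 2 a by auto
      qed
      ultimately show ?thesis using 1 2 by auto
    qed
    have hub: "lam h m = lam h u" if "m \<in> C" "m \<noteq> h" for m
      using fourth[OF huv] huv that by metis
    have rim: "lam i m = lam u v" if "i \<in> C" "m \<in> C" "i \<noteq> m" "i \<noteq> h" "m \<noteq> h" for i m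
    proof -
      have u: "lam u m = lam u v" if "m \<in> C" "m \<noteq> h" "m \<noteq> u" for m
        using fourth[OF huv] that by metis
      show ?thesis
      proof (cases "i = u \<or> m = u")
        case True
        then show ?thesis using u that lam_sym by metis
      next
        case False
        \<comment> \<open>The stems \<open>u\<close> and \<open>m\<close> form a base under the same
          hub, so \<open>fourth\<close> applies to them with \<open>i\<close> as the further
          stem.\<close>
        have "lam h u = lam h m" "lam u m < lam h u" using hub[of m] u[of m] False that huv by auto
        then have "lam m i = lam u m" using fourth[of h u m i] False that huv by metis
        then show ?thesis using u[of m] False that lam_sym by metis
      qed
    qed
    have "lam i m = (if i = h \<or> m = h then lam h u else lam u v)" if "i \<in> C" "m \<in> C" "i \<noteq> m" for i m
      using hub[of m] hub[of i] rim[of i m] lam_sym[of i m] that by auto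
    then have "star C h (lam h u) (lam u v)" using star[OF huv(1) less_imp_le[OF huv(8)]] by blast
    then show ?thesis using jC by blast
  qed
qed

lemma starry_if_unique_geodesics: "unique_geodesics E \<Longrightarrow> starry"
  unfolding starry_def using no_oblique_if_unique_geodesics star_if_unique_geodesics by blast

end

section \<open>The distance in a spider of stars\<close>

definition hubdist :: "int \<Rightarrow> int \<Rightarrow> int \<Rightarrow> int" where
  "hubdist k b a = min (a + b) (\<bar>a - k\<bar> + 1 + \<bar>b - k\<bar>)"

text \<open>For two stems that are both not the hub: they are joined directly in tier
  \<open>l\<close>, and through the hub in tier \<open>k\<close> at the cost of two balks. The last
  argument is the moving tier, the one before it the target tier. Integers avoid truncated
  subtraction.\<close>

definition rimdist :: "int \<Rightarrow> int \<Rightarrow> int \<Rightarrow> int \<Rightarrow> int" where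
  "rimdist k l b a =
     min (a + b) (min (\<bar>a - l\<bar> + 1 + \<bar>b - l\<bar>) (\<bar>a - k\<bar> + 2 + \<bar>b - k\<bar>))"

text \<open>Excludes that both neighbours on the stem are closer. No single candidate falls on both
  sides of \<open>a\<close>, so two different ones do, and parity leaves only the root route below
  and the two-balk route above.\<close>

lemma rimdist_no_peak:
  assumes "0 < l" "l \<le> k" "0 \<le> b" "0 < a"
    "rimdist k l b (a - 1) = rimdist k l b a - 1" "rimdist k l b (a + 1) = rimdist k l b a - 1"
  shows "False"
proof -
  define f where "f = (\<lambda>a. \<bar>a - l\<bar> + 1 + \<bar>b - l\<bar>)"
  define g where "g = (\<lambda>a. \<bar>a - k\<bar> + 2 + \<bar>b - k\<bar>)"
  have rim: "rimdist k l b x = min (x + b) (min (f x) (g x))" for x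
    unfolding rimdist_def f_def g_def by simp
  define v where "v = rimdist k l b a"
  have v: "v \<le> a + b" "v \<le> f a" "v \<le> g a" unfolding v_def rim by simp_all
  have d: "a - 1 + b = v - 1 \<or> f (a - 1) = v - 1 \<or> g (a - 1) = v - 1"
    using assms(5) unfolding v_def[symmetric] unfolding rim by (auto simp: min_def split: if_splits)
  have u: "a + 1 + b = v - 1 \<or> f (a + 1) = v - 1 \<or> g (a + 1) = v - 1"
    using assms(6) unfolding v_def[symmetric] unfolding rim by (auto simp: min_def split: if_splits)
  have peak: "\<not> (f (a - 1) = v - 1 \<and> f (a + 1) = v - 1)" "\<not> (g (a - 1) = v - 1 \<and> g (a + 1) = v - 1)"
    using v unfolding f_def g_def by linarith+
  have par: "even (f x) \<noteq> even (y + b)" "even (g x) = even (y + b)" if "even x = even y" for x y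
    using that unfolding f_def g_def by (auto simp: abs_if)
  have "even (f (a - 1)) \<noteq> even (a + 1 + b)" "even (g (a + 1)) = even (a - 1 + b)"
    "even (f (a + 1)) \<noteq> even (a - 1 + b)" "even (g (a - 1)) = even (a - 1 + b)"
    by (intro par; simp)+
  with d u peak v(1) have tie: "a + b = v" "g (a + 1) = v - 1" by auto
  \<comment> \<open>The root route and the two-balk route tie at \<open>a\<close>, and
    \<open>a\<close> lies below tier \<open>k\<close>. Then the direct balk, in a tier with
    \<open>0 < l \<le> k\<close>, gives a strictly shorter route, although \<open>v\<close> is the
    minimum.\<close>
  then have "f a < a + b" using v assms(1-4) unfolding f_def g_def by (auto simp: abs_if split: if_splits)
  then show False using v tie by simp
qed

lemma hubdist_no_peak:
  assumes "hubdist k b (a - 1) = hubdist k b a - 1" "hubdist k b (a + 1) = hubdist k b a - 1"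
  shows "False"
proof -
  define f where "f = (\<lambda>a. \<bar>a - k\<bar> + 1 + \<bar>b - k\<bar>)"
  have hub: "hubdist k b x = min (x + b) (f x)" for x
    unfolding hubdist_def f_def by simp
  define v where "v = hubdist k b a"
  have v: "v \<le> a + b" "v \<le> f a" unfolding v_def hub by simp_all
  have d: "a - 1 + b = v - 1 \<or> f (a - 1) = v - 1"
    using assms(1) unfolding v_def[symmetric] unfolding hub by (auto simp: min_def split: if_splits)
  have u: "f (a + 1) = v - 1"
    using assms(2) v(1) unfolding v_def[symmetric] unfolding hub by (auto simp: min_def split: if_splits)
  have "\<not> (f (a - 1) = v - 1 \<and> f (a + 1) = v - 1)"
    using v unfolding f_def by linarith+
  moreover have "even (f (a + 1)) \<noteq> even (a - 1 + b)"
    unfolding f_def by (auto simp: abs_if)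
  ultimately show False using d u by auto
qed

text \<open>The root is at distance \<open>b\<close> from the target; so no geodesic leaves it along
  a stem other than the target's. The next lemma is the same for two stems without the hub.\<close>

lemma hubdist_first:
  assumes "0 < k" "0 \<le> b" "hubdist k b 1 = b - 1"
  shows "False"
  using assms unfolding hubdist_def rimdist_def
  by (auto simp: abs_if min_def split: if_splits; presburger)

lemma rimdist_first:
  assumes "0 < l" "l \<le> k" "0 \<le> b" "rimdist k l b 1 = b - 1"
  shows "False"
  using assms unfolding hubdist_def rimdist_def
  by (auto simp: abs_if min_def split: if_splits; presburger)

text \<open>Where the balk in tier \<open>k\<close> onto the target's stem is a descent, the
  distance is |k - b| + 1; this and the next lemma say that no neighbour on the stem is a rival. The
  root route fails by parity, and the balk route has become longer by moving away from the
  balk.\<close>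

lemma hubdist_balk_down:
  assumes "0 < k" "0 \<le> b" "hubdist k b (k - 1) = \<bar>k - b\<bar>"
  shows "False"
  using assms unfolding hubdist_def rimdist_def
  by (auto simp: abs_if min_def split: if_splits; presburger)

lemma hubdist_balk_up:
  assumes "0 < k" "0 \<le> b" "hubdist k b (k + 1) = \<bar>k - b\<bar>"
  shows "False"
  using assms unfolding hubdist_def rimdist_def
  by (auto simp: abs_if min_def split: if_splits; presburger)

lemma rimdist_eqD:
  assumes "rimdist k l b a = v"
  shows "v \<le> a + b" "v \<le> \<bar>a - l\<bar> + 1 + \<bar>b - l\<bar>" "v \<le> \<bar>a - k\<bar> + 2 + \<bar>b - k\<bar>"
    "v = a + b \<or> v = \<bar>a - l\<bar> + 1 + \<bar>b - l\<bar> \<or> v = \<bar>a - k\<bar> + 2 + \<bar>b - k\<bar>"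
  using assms unfolding rimdist_def by (auto simp: min_def split: if_splits)

text \<open>The root route fails by parity, the way back to tier \<open>l\<close> is too long by
  two, and the detour through the hub would violate the triangle inequality for |l - b|.\<close>

lemma rimdist_balk_down: "rimdist k l b (l - 1) \<noteq> \<bar>l - b\<bar>"
proof
  assume "rimdist k l b (l - 1) = \<bar>l - b\<bar>"
  from rimdist_eqD(4)[OF this] consider "\<bar>l - b\<bar> = l - 1 + b" | "\<bar>l - b\<bar> = \<bar>l - 1 - k\<bar> + 2 + \<bar>b - k\<bar>"
    by linarith
  then show False
  proof cases
    case 1
    then show ?thesis by presburger
  qed linarith
qed

lemma rimdist_balk_up: "rimdist k l b (l + 1) \<noteq> \<bar>l - b\<bar>"
proof
  assume "rimdist k l b (l + 1) = \<bar>l - b\<bar>"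
  from rimdist_eqD(4)[OF this] consider "\<bar>l - b\<bar> = l + 1 + b" | "\<bar>l - b\<bar> = \<bar>l + 1 - k\<bar> + 2 + \<bar>b - k\<bar>"
    by linarith
  then show False
  proof cases
    case 1
    then show ?thesis by presburger
  qed linarith
qed

text \<open>If the hub is closer, its own shortest route is the balk: the root route has length
  \<open>k + b\<close>, which is at least the distance from the rim stem.\<close>

lemma rimdist_apex:
  assumes "0 < l" "0 \<le> b" "hubdist k b k = rimdist k l b k - 1"
  shows "rimdist k l b k = \<bar>k - b\<bar> + 2"
proof -
  have "hubdist k b k = k + b \<or> hubdist k b k = 1 + \<bar>b - k\<bar>"
    unfolding hubdist_def by (simp add: min_def)
  then show ?thesis using rimdist_eqD(1)[OF refl, of k l b k] assms by auto
qed

text \<open>The root route could tie only if \<open>k\<close> or \<open>b\<close> is 1, and then the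
  direct balk in tier \<open>l\<close> beats the assumed value at \<open>k\<close>. The direct route
  itself fails by parity.\<close>

lemma rimdist_apex_down:
  assumes "0 < l" "l \<le> k" "0 \<le> b" "rimdist k l b k = \<bar>k - b\<bar> + 2"
  shows "rimdist k l b (k - 1) \<noteq> \<bar>k - b\<bar> + 1"
proof
  assume "rimdist k l b (k - 1) = \<bar>k - b\<bar> + 1"
  from rimdist_eqD(4)[OF this]
  consider "\<bar>k - b\<bar> + 1 = k - 1 + b" | "\<bar>k - b\<bar> + 1 = \<bar>k - 1 - l\<bar> + 1 + \<bar>b - l\<bar>" by linarith
  then show False
  proof cases
    case 1
    then show ?thesis using rimdist_eqD(2)[OF assms(4)] assms(1-3) by linarith
  next
    case 2
    then show ?thesis by presburger
  qed
qed

lemma rimdist_apex_up: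
  assumes "rimdist k l b k = \<bar>k - b\<bar> + 2"
  shows "rimdist k l b (k + 1) \<noteq> \<bar>k - b\<bar> + 1"
proof
  assume "rimdist k l b (k + 1) = \<bar>k - b\<bar> + 1"
  from rimdist_eqD(4)[OF this]
  consider "\<bar>k - b\<bar> + 1 = k + 1 + b" | "\<bar>k - b\<bar> + 1 = \<bar>k + 1 - l\<bar> + 1 + \<bar>b - l\<bar>" by linarith
  then show False
  proof cases
    case 1
    then show ?thesis using rimdist_eqD(1)[OF assms] by linarith
  next
    case 2
    then show ?thesis by presburger
  qed
qed

lemma hubdist_le_rimdist: "hubdist k b k \<le> rimdist k l b k"
  unfolding hubdist_def rimdist_def by linarith

text \<open>Follow a candidate that attains the minimum: down for the root, towards tier
  \<open>l\<close> or \<open>k\<close> for the balks, crossing to the target's stem or to the hub on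
  arrival. As no candidate falls by more than one per step, the minimum falls by exactly one. The
  bound \<open>n\<close> will be the length of the stem.\<close>

lemma rimdist_descends:
  assumes "0 < l" "l \<le> k" "0 \<le> b" "0 < a" "k \<le> n" "a \<le> n"
  shows "rimdist k l b (a - 1) = rimdist k l b a - 1
    \<or> a < n \<and> rimdist k l b (a + 1) = rimdist k l b a - 1
    \<or> a = l \<and> \<bar>a - b\<bar> = rimdist k l b a - 1
    \<or> a = k \<and> hubdist k b a = rimdist k l b a - 1"
proof -
  define f where "f = (\<lambda>a. \<bar>a - l\<bar> + 1 + \<bar>b - l\<bar>)"
  define g where "g = (\<lambda>a. \<bar>a - k\<bar> + 2 + \<bar>b - k\<bar>)"
  have rim: "rimdist k l b x = min (x + b) (min (f x) (g x))" for x
    unfolding rimdist_def f_def g_def by simp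
  define v where "v = rimdist k l b a"
  have v: "v \<le> a + b" "v \<le> f a" "v \<le> g a" unfolding v_def rim by simp_all
  have steep: "f a \<le> f x + 1" "g a \<le> g x + 1" if "x = a - 1 \<or> x = a + 1" for x
    using that unfolding f_def g_def by linarith+
  have next_step: "rimdist k l b x = v - 1"
    if "x = a - 1 \<or> x = a + 1" "x + b = v - 1 \<or> f x = v - 1 \<or> g x = v - 1" for x
    using that v steep[of x] unfolding rim by (auto simp: min_def)
  have "v = a + b \<or> v = f a \<or> v = g a" unfolding v_def rim by (auto simp: min_def)
  then consider "v = a + b" | "v = f a" "a < l" | "v = f a" "l < a" | "v = f a" "a = l"
    | "v = g a" "a < k" | "v = g a" "k < a" | "v = g a" "a = k" by linarith
  then have "rimdist k l b (a - 1) = v - 1 \<or> a < n \<and> rimdist k l b (a + 1) = v - 1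
    \<or> a = l \<and> \<bar>a - b\<bar> = v - 1 \<or> a = k \<and> hubdist k b a = v - 1"
  proof cases
    case 7
    then have "hubdist k b a = v - 1" using v(1) unfolding hubdist_def g_def by (auto simp: min_def)
    then show ?thesis using 7 by simp
  qed (use next_step[of "a - 1"] next_step[of "a + 1"] assms in \<open>auto simp: f_def g_def\<close>)
  then show ?thesis unfolding v_def .
qed

lemma hubdist_descends:
  assumes "0 < k" "0 \<le> b" "0 < a" "k \<le> n" "a \<le> n"
  shows "hubdist k b (a - 1) = hubdist k b a - 1
    \<or> a < n \<and> hubdist k b (a + 1) = hubdist k b a - 1
    \<or> a = k \<and> \<bar>a - b\<bar> = hubdist k b a - 1"
  using assms unfolding hubdist_def by (auto simp: abs_if min_def split: if_splits; presburger)

lemma min_lipschitz: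
  fixes x y x' y' :: int
  assumes "\<bar>x - x'\<bar> \<le> 1" "\<bar>y - y'\<bar> \<le> 1"
  shows "\<bar>min x y - min x' y'\<bar> \<le> 1"
  using assms by linarith

lemma hubdist_lipschitz: "\<bar>hubdist k b (a + 1) - hubdist k b a\<bar> \<le> 1"
  unfolding hubdist_def by (intro min_lipschitz; linarith)

lemma rimdist_lipschitz: "\<bar>rimdist k l b (a + 1) - rimdist k l b a\<bar> \<le> 1"
  unfolding rimdist_def by (intro min_lipschitz; linarith)

section \<open>The explicit formula along the edges of a spider\<close>

context spider begin

text \<open>The distance from the tier-\<open>a\<close> vertex of \<open>i\<close> to the tier-\<open>b\<close> vertex of \<open>j\<close>, where \<open>j\<close> lies in the
  star \<open>C\<close>: the candidates are the routes through the root, along one balk, and along two balks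
  with the hub \<open>h\<close> between them.\<close>

definition stardist :: "'s set \<Rightarrow> 's \<Rightarrow> nat \<Rightarrow> nat \<Rightarrow> 's \<Rightarrow> nat \<Rightarrow> 's \<Rightarrow> nat \<Rightarrow> int" where
  "stardist C h k l j b i a =
     (if i = j then \<bar>int a - int b\<bar>
      else if i \<notin> C then int a + int b
      else if i = h \<or> j = h then hubdist k b a
      else rimdist k l b a)"

lemma stardist_nonneg: "0 \<le> stardist C h k l j b i a"
  unfolding stardist_def hubdist_def rimdist_def by auto

text \<open>The root has coordinates on every stem; its value must not depend on the stem
  chosen.\<close>

lemma stardist_root: "stardist C h k l j b i 0 = int b"
  unfolding stardist_def hubdist_def rimdist_def by auto

lemma stardist_stem_lipschitz: "\<bar>stardist C h k l j b i (Suc a) - stardist C h k l j b i a\<bar> \<le> 1"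
  using hubdist_lipschitz[of "int k" "int b" "int a"] rimdist_lipschitz[of "int k" "int l" "int b" "int a"]
  unfolding stardist_def by (auto simp: add.commute)

context
  fixes C h k l j b
  assumes st: "star C h k l" and jC: "j \<in> C" and b: "b \<le> len j"
begin

abbreviation "sdist \<equiv> stardist C h k l j b"

lemma star_balk_at:
  assumes "i \<in> C"
  shows "balk_at i m a \<longleftrightarrow> m \<in> C \<and> i \<noteq> m \<and> a = (if i = h \<or> m = h then k else l)"
  using assms st unfolding star_def by blast

text \<open>The bounds on \<open>k\<close> and \<open>l\<close> come from balks that the star
  provides: the one between \<open>i\<close> and \<open>j\<close>, and for two rim stems also the
  one from \<open>i\<close> to the hub.\<close>

lemma stardist_cases [case_names same out hub rim]:
  obtains "i = j" "\<And>a. sdist i a = \<bar>int a - int b\<bar>"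
  | "i \<notin> C" "i \<noteq> j" "\<And>a. sdist i a = int a + int b"
  | "i \<in> C" "i \<noteq> j" "i = h \<or> j = h" "\<And>a. sdist i a = hubdist k b a" "0 < int k" "k \<le> len i" "k \<le> len j"
  | "i \<in> C" "i \<noteq> j" "i \<noteq> h" "j \<noteq> h" "\<And>a. sdist i a = rimdist k l b a" "0 < int l" "int l \<le> int k"
    "k \<le> len i" "k \<le> len h" "h \<in> C"
proof -
  consider "i = j" | "i \<notin> C" "i \<noteq> j" | "i \<in> C" "i \<noteq> j" "i = h \<or> j = h"
    | "i \<in> C" "i \<noteq> j" "i \<noteq> h" "j \<noteq> h" by blast
  then show ?thesis
  proof cases
    case 1
    then show ?thesis using that(1) by (simp add: stardist_def)
  next
    case 2
    then show ?thesis using that(2) jC by (simp add: stardist_def)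
  next
    case 3
    then have "balk_at i j k" using star_balk_at[of i j k] jC by auto
    then show ?thesis using that(3) 3 jC balk_at_pos by (auto simp: stardist_def balk_at_def)
  next
    case 4
    moreover have "h \<in> C" "l \<le> k" using st unfolding star_def by auto
    ultimately have "balk_at i j l" "balk_at i h k" using star_balk_at[of i j l] star_balk_at[of i h k] jC by auto
    then show ?thesis using that(4) 4 jC balk_at_pos \<open>h \<in> C\<close> \<open>l \<le> k\<close> by (auto simp: stardist_def balk_at_def)
  qed
qed

lemma stardist_balk_lipschitz:
  assumes "balk_at i m a"
  shows "sdist i a \<le> sdist m a + 1"
proof (cases "i \<in> C")
  case True
  then have "m \<in> C \<and> i \<noteq> m \<and> a = (if i = h \<or> m = h then k else l)" "l \<le> k"
    using st assms unfolding star_def by blast+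
  then show ?thesis using True unfolding stardist_def hubdist_def rimdist_def
    by (auto split: split_min if_splits)
next
  case False
  then have "m \<notin> C" using star_balk_at balk_at_sym[OF assms] by blast
  then show ?thesis using False jC unfolding stardist_def by auto
qed

lemma stardist_descends_root: "0 < b \<Longrightarrow> sdist j 1 = sdist j 0 - 1"
  unfolding stardist_def by auto

lemma stardist_descends_root_unique:
  assumes "sdist m 1 = sdist m 0 - 1"
  shows "m = j"
proof (cases rule: stardist_cases[of m])
  case hub
  then show ?thesis using assms stardist_root[of C h k l j b m] hubdist_first[of k b] by auto
next
  case rim
  then show ?thesis using assms stardist_root[of C h k l j b m] rimdist_first[of l k b] by auto
qed (use assms in auto)

lemma stardist_descends:
  assumes "i \<in> S" "0 < a" "a \<le> len i" "pt i a \<noteq> pt j b"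
  shows "sdist i (a - 1) = sdist i a - 1 \<or> (a < len i \<and> sdist i (Suc a) = sdist i a - 1)
    \<or> (\<exists>m. balk_at i m a \<and> sdist m a = sdist i a - 1)"
proof -
  have ints: "int (a - 1) = int a - 1" "int (Suc a) = int a + 1" "0 < int a" "0 \<le> int b"
    "int a \<le> int (len i)" using assms by auto
  show ?thesis
  proof (cases rule: stardist_cases[of i])
    case same
    then have "a \<noteq> b" using assms by blast
    then show ?thesis using same b assms by auto
  next
    case out
    then show ?thesis using assms by auto
  next
    case hub
    note at = hub(4)[of "a - 1", unfolded ints(1)] hub(4)[of "Suc a", unfolded ints(2)] hub(4)[of a]
    have "balk_at i j k" using star_balk_at[of i j k] hub jC by auto
    moreover have "sdist j a = \<bar>int a - int b\<bar>" by (simp add: stardist_def)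
    ultimately show ?thesis using hubdist_descends[of k b a "len i"] hub(5,6) ints(3-5) unfolding at by auto
  next
    case rim
    note at = rim(5)[of "a - 1", unfolded ints(1)] rim(5)[of "Suc a", unfolded ints(2)] rim(5)[of a]
    have "balk_at i j l" "balk_at i h k" using star_balk_at[of i j l] star_balk_at[of i h k] rim jC by auto
    moreover have "sdist h a = hubdist k b a" "sdist j a = \<bar>int a - int b\<bar>"
      using rim by (auto simp: stardist_def)
    ultimately show ?thesis using rimdist_descends[of l k b a "len i"] rim(6-8) ints(3-5)
      unfolding at by auto
  qed
qed

lemma stardist_descent_stem:
  assumes "0 < a" "sdist i (a - 1) = sdist i a - 1"
  shows "sdist i (Suc a) \<noteq> sdist i a - 1"
proof -
  have ints: "int (a - 1) = int a - 1" "int (Suc a) = int a + 1" "0 < int a" "0 \<le> int b"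
    using assms by auto
  show ?thesis
  proof (cases rule: stardist_cases[of i])
    case hub
    note at = hub(4)[of "a - 1", unfolded ints(1)] hub(4)[of "Suc a", unfolded ints(2)] hub(4)[of a]
    show ?thesis using hubdist_no_peak[of k b a] assms(2) unfolding at by blast
  next
    case rim
    note at = rim(5)[of "a - 1", unfolded ints(1)] rim(5)[of "Suc a", unfolded ints(2)] rim(5)[of a]
    show ?thesis using rimdist_no_peak[of l k b a] rim(6,7) ints(3,4) assms(2) unfolding at by blast
  qed (use ints assms in auto)
qed

text \<open>A balk between two stems in the same position relative to \<open>j\<close> keeps the
  distance, and one that leaves the hub for another rim stem cannot lower it. What remains is a balk
  onto the stem of \<open>j\<close>, or one from the rim to the hub.\<close>

lemma stardist_balk_descent:
  assumes "balk_at i m a" "sdist m a = sdist i a - 1"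
  shows "i \<noteq> j" "i \<in> C" "m = j \<or> (m = h \<and> i \<noteq> h \<and> j \<noteq> h \<and> a = k \<and> sdist i k = \<bar>int k - int b\<bar> + 2)"
proof -
  show "i \<in> C"
  proof (rule ccontr)
    assume i: "i \<notin> C"
    then have "m \<notin> C" using star_balk_at balk_at_sym[OF assms(1)] by blast
    moreover have "i \<noteq> j" "m \<noteq> j" using i \<open>m \<notin> C\<close> jC by auto
    ultimately show False using i assms(2) by (simp add: stardist_def)
  qed
  then have m: "m \<in> C" "i \<noteq> m" "a = (if i = h \<or> m = h then k else l)"
    using star_balk_at assms(1) by auto
  show ij: "i \<noteq> j"
  proof
    assume "i = j"
    then show False using assms(2) m \<open>i \<in> C\<close>
      by (auto simp: stardist_def hubdist_def rimdist_def split: split_min if_splits)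
  qed
  show "m = j \<or> (m = h \<and> i \<noteq> h \<and> j \<noteq> h \<and> a = k \<and> sdist i k = \<bar>int k - int b\<bar> + 2)"
  proof (cases "m = j")
    case mj: False
    consider "j = h" | "j \<noteq> h" "m = h" | "j \<noteq> h" "i = h" | "j \<noteq> h" "i \<noteq> h" "m \<noteq> h" by blast
    then show ?thesis
    proof cases
      case 1
      then have "sdist m a = sdist i a" using ij mj m \<open>i \<in> C\<close> by (simp add: stardist_def)
      then show ?thesis using assms(2) by simp
    next
      case 2
      then have "sdist m k = hubdist k b k" "sdist i k = rimdist k l b k" "a = k" "i \<noteq> h"
        using ij mj m \<open>i \<in> C\<close> by (auto simp: stardist_def)
      moreover have "0 < int l"
        using star_balk_at[of i j l] 2 \<open>i \<noteq> h\<close> ij \<open>i \<in> C\<close> jC balk_at_pos[of i j l] by auto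
      ultimately show ?thesis using 2 assms(2) rimdist_apex[of l b k] by auto
    next
      case 3
      then have "sdist i k = hubdist k b k" "sdist m k = rimdist k l b k" "a = k"
        using ij mj m \<open>i \<in> C\<close> by (auto simp: stardist_def)
      then show ?thesis using assms(2) hubdist_le_rimdist[of k b l] by auto
    next
      case 4
      then have "sdist m a = sdist i a" using ij mj m \<open>i \<in> C\<close> by (simp add: stardist_def)
      then show ?thesis using assms(2) by simp
    qed
  qed simp
qed

lemma stardist_descent_balk_stem:
  assumes "0 < a" "balk_at i m a" "sdist m a = sdist i a - 1"
  shows "sdist i (a - 1) \<noteq> sdist i a - 1" "sdist i (Suc a) \<noteq> sdist i a - 1"
proof -
  note desc = stardist_balk_descent[OF assms(2,3)]
  have a: "a = (if i = h \<or> m = h then k else l)" using star_balk_at desc(2) assms(2) by blast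
  have ints: "int (a - 1) = int a - 1" "int (Suc a) = int a + 1" "0 \<le> int b" using assms by auto
  have j: "sdist j a = \<bar>int a - int b\<bar>" by (simp add: stardist_def)
  have "sdist i (a - 1) \<noteq> sdist i a - 1 \<and> sdist i (Suc a) \<noteq> sdist i a - 1"
  proof (cases rule: stardist_cases[of i])
    case hub
    note at = hub(4)[of "a - 1", unfolded ints(1)] hub(4)[of "Suc a", unfolded ints(2)] hub(4)[of a]
    have "a = k" "m = j" using hub a desc(3) by auto
    then show ?thesis using hub(5) assms(3) j ints(3) hubdist_balk_down[of k b] hubdist_balk_up[of k b]
      unfolding at by auto
  next
    case rim
    note at = rim(5)[of "a - 1", unfolded ints(1)] rim(5)[of "Suc a", unfolded ints(2)] rim(5)[of a]
    show ?thesis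
    proof (cases "m = j")
      case True
      then have "a = l" using a rim by auto
      then show ?thesis using assms(3) j True rimdist_balk_down[of k l b] rimdist_balk_up[of k l b]
        unfolding at by auto
    next
      case False
      then have "a = k" "sdist i k = \<bar>int k - int b\<bar> + 2" using desc(3) by auto
      then show ?thesis using rim(5)[of k] rim(6,7) ints(3) rimdist_apex_down[of l k b] rimdist_apex_up[of k l b]
        unfolding at by auto
    qed
  qed (use desc in auto)
  then show "sdist i (a - 1) \<noteq> sdist i a - 1" "sdist i (Suc a) \<noteq> sdist i a - 1" by auto
qed

lemma stardist_descent_balks:
  assumes "sdist m a = sdist i a - 1" "sdist m' a = sdist i a - 1" "balk_at i m a" "balk_at i m' a"
  shows "m = m'"
proof -
  \<comment> \<open>The two kinds of descending balk exclude each other: a step onto the target's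
    stem starts at value |k - b| + 1, a step to the hub at |k - b| + 2.\<close>
  have False if "sdist j a = sdist i a - 1" "sdist i k = \<bar>int k - int b\<bar> + 2" "a = k"
    using that by (simp add: stardist_def)
  then show ?thesis
    using stardist_balk_descent(3)[OF assms(3,1)] stardist_balk_descent(3)[OF assms(4,2)] assms(1,2)
    by blast
qed

end

lemma unique_geodesics_if_starry:
  assumes "starry"
  shows "unique_geodesics E"
proof -
  have no: no_oblique and stars: "\<forall>j \<in> S. \<exists>C h k l. j \<in> C \<and> star C h k l"
    using assms unfolding starry_def by auto
  have coords: "\<exists>i a. i \<in> S \<and> a \<le> len i \<and> u = pt i a" if "u \<in> Field E" for u
    using that E_on_stem E_sym unfolding Field_def by blast
  define stm where "stm v = (SOME i. i \<in> S \<and> (\<exists>a \<le> len i. v = pt i a))" for v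
  define tr where "tr v = (SOME a. a \<le> len (stm v) \<and> v = pt (stm v) a)" for v
  have stm: "stm v \<in> S" and tr: "tr v \<le> len (stm v)" "pt (stm v) (tr v) = v" if v: "v \<in> Field E" for v
  proof -
    have "\<exists>i. i \<in> S \<and> (\<exists>a \<le> len i. v = pt i a)" using coords[OF v] by blast
    then have "stm v \<in> S \<and> (\<exists>a \<le> len (stm v). v = pt (stm v) a)" unfolding stm_def by (rule someI_ex)
    then have "stm v \<in> S" and ex: "\<exists>a. a \<le> len (stm v) \<and> v = pt (stm v) a" by blast+
    then show "stm v \<in> S" by blast
    from someI_ex[OF ex] show "tr v \<le> len (stm v)" "pt (stm v) (tr v) = v" unfolding tr_def by simp_all
  qed
  have "\<forall>j. \<exists>C h k l. j \<in> S \<longrightarrow> j \<in> C \<and> star C h k l" using stars by blast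
  then obtain C h k l where star: "j \<in> S \<Longrightarrow> j \<in> C j \<and> star (C j) (h j) (k j) (l j)" for j
    by metis
  define sd where "sd v = stardist (C (stm v)) (h (stm v)) (k (stm v)) (l (stm v)) (stm v) (tr v)" for v
  \<comment> \<open>The explicit zero serves points outside the field of \<open>E\<close>, where
    \<open>stm\<close> and \<open>tr\<close> are arbitrary.\<close>
  define d where "d u v = (if u = v then 0 else nat (sd v (stm u) (tr u)))" for u v
  have sd0: "sd v i 0 = tr v" for v i unfolding sd_def by (rule stardist_root)
  have sd_nonneg: "0 \<le> sd v i a" for v i a unfolding sd_def by (rule stardist_nonneg)
  \<comment> \<open>Any coordinates of a point may be used: only the root has several, and there
    \<open>sd0\<close> gives the same value on every stem.\<close>
  have d: "int (d (pt i a) v) = sd v i a" if "i \<in> S" "a \<le> len i" "v \<in> Field E" "pt i a \<in> Field E" for i a v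
  proof -
    have eq: "tr u = a \<and> (stm u = i \<or> a = 0)" if "u = pt i a" "u \<in> Field E" for u
      using that pt_eq_iff[of "stm u" i "tr u" a] \<open>i \<in> S\<close> \<open>a \<le> len i\<close> stm[of u] tr[of u] by auto
    have "sd v i a = sd v (stm (pt i a)) (tr (pt i a))" using eq[of "pt i a"] that sd0 by auto
    moreover have "sd v i a = 0" if "v = pt i a"
      using eq[of v] \<open>v \<in> Field E\<close> that sd0[of v i] unfolding sd_def by (auto simp: stardist_def)
    ultimately show ?thesis unfolding d_def using sd_nonneg[of v] by auto
  qed
  have balk_field: "pt i a \<in> Field E" "pt m a \<in> Field E" "i \<in> S" "m \<in> S" "a \<le> len i" "a \<le> len m"
    "(pt i a, pt m a) \<in> E" if "balk_at i m a" for i m a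
    using that unfolding balk_at_def Field_def by auto
  show ?thesis
  proof (rule unique_geodesicsI_distance)
    show "d v v = 0" for v by (simp add: d_def)
  next
    fix u w v
    assume uw: "(u, w) \<in> E" and v: "v \<in> Field E"
    have F: "u \<in> Field E" "w \<in> Field E" using uw by (auto simp: Field_def)
    obtain i a where i: "i \<in> S" "a \<le> len i" "u = pt i a" using coords F by blast
    note du = d[OF i(1,2) v] and lip = stardist_stem_lipschitz[of "C (stm v)" "h (stm v)" "k (stm v)"
        "l (stm v)" "stm v" "tr v", folded sd_def]
    have "int (d u v) \<le> int (d w v) + 1"
    proof (cases "a = 0")
      case True
      then have "u = r" using i pt_0 by simp
      have "(r, w) \<in> E" "S \<noteq> {}" using uw \<open>u = r\<close> i by auto
      then obtain m where m: "m \<in> S" "1 \<le> len m" "w = pt m 1" by (rule root_neighbour)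
      then show ?thesis using d[of m 0 v] d[of m 1 v] \<open>u = r\<close> pt_0 v F lip[of m 0] by auto
    next
      case False
      then have "0 < a" by simp
      from no i(1) this i(2) uw[unfolded i(3)] show ?thesis
      proof (cases rule: neighbour_cases)
        case down
        have "int (d w v) = sd v i (a - 1)" unfolding down by (rule d) (use down i v F in auto)
        then show ?thesis using du i F lip[of i "a - 1"] \<open>0 < a\<close> by simp
      next
        case up
        then show ?thesis using du d[of i "Suc a" v] i v F lip[of i a] by auto
      next
        case (balk m)
        have "sd v i a \<le> sd v m a + 1" unfolding sd_def
          by (rule stardist_balk_lipschitz) (use star stm tr v balk in auto)
        then show ?thesis using balk du d[of m a v] i v F balk_field[OF balk(1)] by auto
      qed
    qed
    then show "d u v \<le> Suc (d w v)" by simp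
  next
    fix u v
    assume u: "u \<in> Field E" and v: "v \<in> Field E" and uv: "u \<noteq> v"
    note sv = star[OF stm[OF v]] and tv = tr[OF v]
    obtain i a where i: "i \<in> S" "a \<le> len i" "u = pt i a" using coords u by blast
    note du = d[OF i(1,2) v]
    have "\<exists>w. (u, w) \<in> E \<and> int (d w v) = int (d u v) - 1"
    proof (cases "a = 0")
      case True
      then have "u = r" using i pt_0 by simp
      then have pos: "0 < tr v" using uv tv stm[OF v] pt_0 by (metis gr0I)
      then have e: "(r, pt (stm v) 1) \<in> E" using stem_edge[of "stm v" 0] stm[OF v] tv pt_0 by simp
      then have "pt (stm v) 1 \<in> Field E" by (auto simp: Field_def)
      moreover have "sd v (stm v) 1 = sd v (stm v) 0 - 1"
        unfolding sd_def using stardist_descends_root pos sv tv by blast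
      ultimately show ?thesis
        using e d[of "stm v" 0 v] d[of "stm v" 1 v] \<open>u = r\<close> stm[OF v] pos tv(1) v u pt_0
        by (intro exI[of _ "pt (stm v) 1"]) auto
    next
      case False
      then have "0 < a" by simp
      have "sd v i (a - 1) = sd v i a - 1 \<or> (a < len i \<and> sd v i (Suc a) = sd v i a - 1)
        \<or> (\<exists>m. balk_at i m a \<and> sd v m a = sd v i a - 1)"
        unfolding sd_def by (rule stardist_descends) (use sv tv i uv \<open>0 < a\<close> in auto)
      then consider "sd v i (a - 1) = sd v i a - 1" | "a < len i" "sd v i (Suc a) = sd v i a - 1"
        | m where "balk_at i m a" "sd v m a = sd v i a - 1" by blast
      then show ?thesis
      proof cases
        case 1
        have e: "(pt i a, pt i (a - 1)) \<in> E" using stem_edge[of i "a - 1"] E_sym i \<open>0 < a\<close> by simp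
        then have "pt i (a - 1) \<in> Field E" by (auto simp: Field_def)
        then show ?thesis using 1 e i du u v d[of i "a - 1" v] by (intro exI[of _ "pt i (a - 1)"]) auto
      next
        case 2
        have e: "(pt i a, pt i (Suc a)) \<in> E" using stem_edge[of i a] i 2 by simp
        then have "pt i (Suc a) \<in> Field E" by (auto simp: Field_def)
        then show ?thesis using 2 e i du u v d[of i "Suc a" v] by (intro exI[of _ "pt i (Suc a)"]) auto
      next
        case 3
        then show ?thesis using i du u v d[of m a v] balk_field[OF 3(1)]
          by (intro exI[of _ "pt m a"]) auto
      qed
    qed
    then obtain w where "(u, w) \<in> E" "int (d w v) = int (d u v) - 1" by blast
    then have "(u, w) \<in> E" "d u v = Suc (d w v)" by auto
    then show "\<exists>w. (u, w) \<in> E \<and> d u v = Suc (d w v)" by blast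
  next
    fix u w w' v
    assume e: "(u, w) \<in> E" "(u, w') \<in> E" and v: "v \<in> Field E" and uv: "u \<noteq> v"
      and dw: "d u v = Suc (d w v)" "d u v = Suc (d w' v)"
    have F: "u \<in> Field E" "w \<in> Field E" "w' \<in> Field E" using e by (auto simp: Field_def)
    note sv = star[OF stm[OF v], THEN conjunct2] star[OF stm[OF v], THEN conjunct1] tr(1)[OF v]
    obtain i a where i: "i \<in> S" "a \<le> len i" "u = pt i a" using coords F by blast
    note du = d[OF i(1,2) v]
    show "w = w'"
    proof (cases "a = 0")
      case True
      then have ur: "u = r" using i pt_0 by simp
      have "\<exists>m. w = pt m 1 \<and> m = stm v" if "(u, w) \<in> E" "d u v = Suc (d w v)" "w \<in> Field E" for w
      proof -
        have "(r, w) \<in> E" "S \<noteq> {}" using that(1) ur i by auto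
        then obtain m where m: "m \<in> S" "1 \<le> len m" "w = pt m 1" by (rule root_neighbour)
        then have "sd v m 1 = sd v m 0 - 1"
          using d[of m 0 v] d[of m 1 v] ur pt_0 v F that by auto
        then have "m = stm v" unfolding sd_def using stardist_descends_root_unique sv by blast
        then show ?thesis using m by blast
      qed
      then show ?thesis using e dw F by metis
    next
      case False
      then have "0 < a" by simp
      have N: "(w = pt i (a - 1) \<and> sd v i (a - 1) = sd v i a - 1) \<or> (w = pt i (Suc a) \<and> sd v i (Suc a) = sd v i a - 1)
        \<or> (\<exists>m. w = pt m a \<and> balk_at i m a \<and> sd v m a = sd v i a - 1)"
        if w: "(u, w) \<in> E" "d u v = Suc (d w v)" "w \<in> Field E" for w
      proof -
        from no i(1) \<open>0 < a\<close> i(2) w(1)[unfolded i(3)] show ?thesis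
        proof (cases rule: neighbour_cases)
          case down
          then show ?thesis using du d[of i "a - 1" v] i v F w by auto
        next
          case up
          then show ?thesis using du d[of i "Suc a" v] i v F w by auto
        next
          case (balk m)
          then show ?thesis using du d[of m a v] i v F w balk_field[OF balk(1)] by auto
        qed
      qed
      have stem: "sd v i (a - 1) = sd v i a - 1 \<Longrightarrow> sd v i (Suc a) \<noteq> sd v i a - 1"
        unfolding sd_def by (rule stardist_descent_stem[OF sv \<open>0 < a\<close>])
      have balk_stem: "balk_at i m a \<Longrightarrow> sd v m a = sd v i a - 1 \<Longrightarrow>
          sd v i (a - 1) \<noteq> sd v i a - 1 \<and> sd v i (Suc a) \<noteq> sd v i a - 1" for m
        unfolding sd_def using stardist_descent_balk_stem[OF sv \<open>0 < a\<close>] by simp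
      have balks: "balk_at i m a \<Longrightarrow> sd v m a = sd v i a - 1 \<Longrightarrow> balk_at i m' a \<Longrightarrow> sd v m' a = sd v i a - 1 \<Longrightarrow> m = m'" for m m'
        unfolding sd_def by (rule stardist_descent_balks[OF sv])
      show ?thesis using N[OF e(1) dw(1) F(2)] N[OF e(2) dw(2) F(3)]
        by (elim disjE exE conjE) (use stem balk_stem balks in blast)+
    qed
  qed
qed

theorem unique_geodesics_iff_starry: "unique_geodesics E \<longleftrightarrow> starry"
  using unique_geodesics_if_starry starry_if_unique_geodesics by blast

end

section \<open>Blocks\<close>

text \<open>Connectedness is expressed by arcs across every cut \<open>X\<close>; the set \<open>Z\<close> is empty or consists of one
  deleted vertex.\<close>

definition biconnected :: "'a set \<Rightarrow> 'a rel \<Rightarrow> bool" where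
  "biconnected V A \<longleftrightarrow> (\<forall>Z X x y. (\<forall>z \<in> Z. \<forall>z' \<in> Z. z = z') \<longrightarrow> x \<in> V \<inter> X - Z \<longrightarrow> y \<in> V - X - Z \<longrightarrow>
     (\<exists>p q. (p, q) \<in> A \<and> p \<in> X - Z \<and> q \<notin> X \<union> Z))"

lemma biconnectedD:
  assumes "biconnected V A" "\<And>z z'. z \<in> Z \<Longrightarrow> z' \<in> Z \<Longrightarrow> z = z'"
    "x \<in> V" "x \<in> X" "x \<notin> Z" "y \<in> V" "y \<notin> X" "y \<notin> Z"
  obtains p q where "(p, q) \<in> A" "p \<in> X" "p \<notin> Z" "q \<notin> X" "q \<notin> Z"
proof -
  have "x \<in> V \<inter> X - Z" "y \<in> V - X - Z" using assms by auto
  then show ?thesis using assms(1,2) that unfolding biconnected_def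
    by (metis DiffD1 DiffD2 UnI1 UnI2)
qed

lemma biconnected_avoiding:
  assumes "biconnected V A" "x \<in> V" "x \<in> X" "x \<noteq> z" "y \<in> V" "y \<notin> X" "y \<noteq> z"
  obtains p q where "(p, q) \<in> A" "p \<in> X" "p \<noteq> z" "q \<notin> X" "q \<noteq> z"
  using biconnectedD[of V A "{z}" x X y] assms by auto

lemma biconnectedI:
  assumes "\<And>Z X x y. (\<And>z z'. z \<in> Z \<Longrightarrow> z' \<in> Z \<Longrightarrow> z = z') \<Longrightarrow> x \<in> V \<Longrightarrow> x \<in> X \<Longrightarrow> x \<notin> Z \<Longrightarrow>
    y \<in> V \<Longrightarrow> y \<notin> X \<Longrightarrow> y \<notin> Z \<Longrightarrow> \<exists>p q. (p, q) \<in> A \<and> p \<in> X \<and> p \<notin> Z \<and> q \<notin> X \<and> q \<notin> Z"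
  shows "biconnected V A"
  unfolding biconnected_def
proof (intro allI impI)
  fix Z X x y
  assume "\<forall>z \<in> Z. \<forall>z' \<in> Z. z = z'" "x \<in> V \<inter> X - Z" "y \<in> V - X - Z"
  then have "\<exists>p q. (p, q) \<in> A \<and> p \<in> X \<and> p \<notin> Z \<and> q \<notin> X \<and> q \<notin> Z"
    by (intro assms[where x = x and y = y]) auto
  then show "\<exists>p q. (p, q) \<in> A \<and> p \<in> X - Z \<and> q \<notin> X \<union> Z" by blast
qed

lemma reachable_crossing:
  assumes "x \<rightarrow>\<^sup>*\<^bsub>H\<^esub> y" "x \<in> X" "y \<notin> X"
  obtains p q where "(p, q) \<in> arcs_ends H" "p \<in> X" "q \<notin> X"
proof -
  have "(x, y) \<in> (arcs_ends H)\<^sup>*" using assms(1) by (rule reachable_rtranclI)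
  then have "y \<notin> X \<Longrightarrow> \<exists>p q. (p, q) \<in> arcs_ends H \<and> p \<in> X \<and> q \<notin> X"
    by (induction rule: rtrancl_induct) (use assms(2) in auto)
  then show ?thesis using that assms(3) by blast
qed

lemma reachable_if_crossing:
  assumes "wf_digraph H" "x \<in> verts H"
    "\<And>X. x \<in> X \<Longrightarrow> y \<notin> X \<Longrightarrow> \<exists>p q. (p, q) \<in> arcs_ends H \<and> p \<in> X \<and> q \<notin> X"
  shows "x \<rightarrow>\<^sup>*\<^bsub>H\<^esub> y"
proof (rule ccontr)
  interpret wf_digraph H by fact
  assume y: "\<not> x \<rightarrow>\<^sup>*\<^bsub>H\<^esub> y"
  have "x \<rightarrow>\<^sup>*\<^bsub>H\<^esub> x" using assms(2) by simp
  then obtain p q where "(p, q) \<in> arcs_ends H" "x \<rightarrow>\<^sup>*\<^bsub>H\<^esub> p" "\<not> x \<rightarrow>\<^sup>*\<^bsub>H\<^esub> q"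
    using assms(3)[of "{w. x \<rightarrow>\<^sup>*\<^bsub>H\<^esub> w}"] y by auto
  then show False using reachable_adj_trans by blast
qed

lemma arcs_ends_del_vert:
  "arcs_ends (pre_digraph.del_vert (with_proj B) v) = {(p, q) \<in> parcs B. p \<noteq> v \<and> q \<noteq> v}"
  by (auto simp: arcs_ends_def arc_to_ends_def pre_digraph.del_vert_def)

text \<open>A cut that no arc crosses arises as the set of vertices reachable from \<open>x\<close>,
  in the whole graph for \<open>Z = {}\<close> and after deletion for \<open>Z = {v}\<close>. A
  \<open>Z\<close> that misses the graph acts like the empty set.\<close>

lemma connected_no_cut_iff_biconnected:
  assumes "wf_digraph (with_proj B)" "symmetric (with_proj B)" "pverts B \<noteq> {}"
  shows "connected B \<and> \<not> (\<exists>v. cut_vertex B v) \<longleftrightarrow> biconnected (pverts B) (parcs B)"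
proof
  interpret wf_digraph B by fact
  have conn: "connected B \<longleftrightarrow> (\<forall>x \<in> pverts B. \<forall>y \<in> pverts B. x \<rightarrow>\<^sup>*\<^bsub>with_proj B\<^esub> y)"
    using assms(3) reachable_mk_symmetric_eq[OF assms(2)] by (simp add: connected_def strongly_connected_def)
  show "biconnected (pverts B) (parcs B)" if B: "connected B \<and> \<not> (\<exists>v. cut_vertex B v)"
  proof (rule biconnectedI)
    fix Z X x y
    assume Z: "\<And>z z'. z \<in> Z \<Longrightarrow> z' \<in> Z \<Longrightarrow> z = (z' :: 'a)"
      and h: "x \<in> pverts B" "x \<in> X" "x \<notin> Z" "y \<in> pverts B" "y \<notin> X" "y \<notin> Z"
    have r: "x \<rightarrow>\<^sup>*\<^bsub>with_proj B\<^esub> y" using B conn h by blast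
    show "\<exists>p q. (p, q) \<in> parcs B \<and> p \<in> X \<and> p \<notin> Z \<and> q \<notin> X \<and> q \<notin> Z"
    proof (cases "Z \<inter> pverts B = {}")
      case True
      obtain p q where "(p, q) \<in> parcs B" "p \<in> X" "q \<notin> X"
        using reachable_crossing[OF r h(2,5)] by auto
      then show ?thesis using True wellformed by fastforce
    next
      case False
      then obtain z where z: "Z = {z}" "z \<in> pverts B" using Z by auto
      then have "x \<rightarrow>\<^sup>*\<^bsub>pre_digraph.del_vert (with_proj B) z\<^esub> y"
        using B r h unfolding cut_vertex_def by auto
      then obtain p q where "(p, q) \<in> arcs_ends (pre_digraph.del_vert (with_proj B) z)" "p \<in> X" "q \<notin> X"
        using reachable_crossing[OF _ h(2,5)] by blast
      then show ?thesis using z unfolding arcs_ends_del_vert by blast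
    qed
  qed
  show "connected B \<and> \<not> (\<exists>v. cut_vertex B v)" if B: "biconnected (pverts B) (parcs B)"
  proof
    show "connected B" unfolding conn
    proof (intro ballI)
      fix x y assume "x \<in> pverts B" "y \<in> pverts B"
      then show "x \<rightarrow>\<^sup>*\<^bsub>with_proj B\<^esub> y"
        by (intro reachable_if_crossing[OF assms(1)])
          (use biconnectedD[OF B, of "{}"] in \<open>auto, metis\<close>)
    qed
    show "\<not> (\<exists>v. cut_vertex B v)"
    proof
      assume "\<exists>v. cut_vertex B v"
      then obtain v x y where v: "x \<in> pverts B - {v}" "y \<in> pverts B - {v}"
        "\<not> x \<rightarrow>\<^sup>*\<^bsub>pre_digraph.del_vert (with_proj B) v\<^esub> y"
        unfolding cut_vertex_def by auto
      have "x \<rightarrow>\<^sup>*\<^bsub>pre_digraph.del_vert (with_proj B) v\<^esub> y"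
      proof (rule reachable_if_crossing)
        fix X assume X: "x \<in> X" "y \<notin> X"
        obtain p q where "(p, q) \<in> parcs B" "p \<in> X" "p \<notin> {v}" "q \<notin> X" "q \<notin> {v}"
          using biconnectedD[OF B, of "{v}" x X y] X v by auto
        then show "\<exists>p q. (p, q) \<in> arcs_ends (pre_digraph.del_vert (with_proj B) v) \<and> p \<in> X \<and> q \<notin> X"
          unfolding arcs_ends_del_vert by blast
      qed (use v wf_digraph_del_vert in \<open>auto simp: pre_digraph.del_vert_def\<close>)
      then show False using v by blast
    qed
  qed
qed

text \<open>A symmetric connected subgraph without cut vertex, given as a pair of sets so that union
  and inclusion are those of sets. Blocks are the maximal pieces.\<close>

definition piece :: "'a pair_pre_digraph \<Rightarrow> 'a set \<Rightarrow> 'a rel \<Rightarrow> bool" where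
  "piece G V A \<longleftrightarrow> V \<noteq> {} \<and> V \<subseteq> pverts G \<and> A \<subseteq> parcs G \<and> A \<subseteq> V \<times> V \<and> sym A \<and> biconnected V A"

text \<open>\<open>max_subgraph\<close> ranges over digraphs with arbitrary tail and head maps;
  compatibility with \<open>G\<close> forces these to be the projections.\<close>

lemma subgraph_with_proj_iff:
  assumes "wf_digraph (with_proj G)"
  shows "subgraph H G \<longleftrightarrow> (\<exists>V A. H = with_proj \<lparr>pverts = V, parcs = A\<rparr> \<and> V \<subseteq> pverts G \<and> A \<subseteq> parcs G \<and> A \<subseteq> V \<times> V)"
proof
  assume "subgraph H G"
  then have H: "verts H \<subseteq> pverts G" "arcs H \<subseteq> parcs G" "wf_digraph H" "tail H = fst" "head H = snd"
    by (auto simp: subgraph_def compatible_def)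
  then have "H = with_proj \<lparr>pverts = verts H, parcs = arcs H\<rparr>"
    by (simp add: with_proj_def)
  moreover have "arcs H \<subseteq> verts H \<times> verts H"
    using H wf_digraph.tail_in_verts[OF H(3)] wf_digraph.head_in_verts[OF H(3)] by fastforce
  ultimately show "\<exists>V A. H = with_proj \<lparr>pverts = V, parcs = A\<rparr> \<and> V \<subseteq> pverts G \<and> A \<subseteq> parcs G \<and> A \<subseteq> V \<times> V"
    using H by blast
next
  assume "\<exists>V A. H = with_proj \<lparr>pverts = V, parcs = A\<rparr> \<and> V \<subseteq> pverts G \<and> A \<subseteq> parcs G \<and> A \<subseteq> V \<times> V"
  then show "subgraph H G" using assms
    by (auto simp: subgraph_def compatible_def wf_digraph_def)
qed

lemma piece_iff_subgraph:
  assumes "wf_digraph (with_proj G)"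
  shows "piece G V A \<longleftrightarrow> subgraph (with_proj \<lparr>pverts = V, parcs = A\<rparr>) G \<and>
    symmetric (with_proj \<lparr>pverts = V, parcs = A\<rparr>) \<and> connected (with_proj \<lparr>pverts = V, parcs = A\<rparr>) \<and>
    \<not> (\<exists>v. cut_vertex (with_proj \<lparr>pverts = V, parcs = A\<rparr>) v)"
proof -
  let ?B = "\<lparr>pverts = V, parcs = A\<rparr>"
  have inj: "with_proj ?B = with_proj \<lparr>pverts = V', parcs = A'\<rparr> \<longleftrightarrow> V = V' \<and> A = A'" for V' A'
    by (auto simp: with_proj_def)
  have "subgraph (with_proj ?B) G \<longleftrightarrow> V \<subseteq> pverts G \<and> A \<subseteq> parcs G \<and> A \<subseteq> V \<times> V"
    unfolding subgraph_with_proj_iff[OF assms] inj by blast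
  moreover have "wf_digraph (with_proj ?B)" if "A \<subseteq> V \<times> V"
    using that by (auto simp: wf_digraph_def)
  moreover have "symmetric (with_proj ?B) \<longleftrightarrow> sym A" by (simp add: symmetric_def)
  moreover have "V \<noteq> {}" if "connected (with_proj ?B)"
    using that by (auto simp: connected_def strongly_connected_def)
  ultimately show ?thesis unfolding piece_def
    using connected_no_cut_iff_biconnected[of ?B] by (metis pair_pre_digraph.select_convs)
qed

lemma block_iff_max_piece:
  assumes "wf_digraph (with_proj G)"
  shows "block G B \<longleftrightarrow> piece G (pverts B) (parcs B) \<and>
    (\<forall>V A. piece G V A \<longrightarrow> pverts B \<subseteq> V \<longrightarrow> parcs B \<subseteq> A \<longrightarrow> V = pverts B \<and> A = parcs B)"
proof -
  have eta: "\<lparr>pverts = pverts B, parcs = parcs B\<rparr> = B" by simp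
  have inj: "with_proj \<lparr>pverts = V, parcs = A\<rparr> = with_proj B \<longleftrightarrow> V = pverts B \<and> A = parcs B" for V A
    by (cases B) (auto simp: with_proj_def)
  have sub: "subgraph (with_proj B) (with_proj \<lparr>pverts = V, parcs = A\<rparr>) \<longleftrightarrow> pverts B \<subseteq> V \<and> parcs B \<subseteq> A"
    if "piece G V A" "piece G (pverts B) (parcs B)" for V A
    using that by (auto simp: subgraph_def compatible_def piece_def wf_digraph_def)
  show ?thesis
    unfolding block_def pre_digraph.max_subgraph_def
    using piece_iff_subgraph[OF assms] subgraph_with_proj_iff[OF assms] sub inj eta by metis
qed

text \<open>One deleted vertex cannot remove both \<open>p\<close> and \<open>q\<close>. On
  whichever side of the cut the survivor \<open>g\<close> lies, it is separated from
  \<open>x\<close> or from \<open>y\<close> inside one of the two pieces.\<close>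

lemma piece_union:
  assumes "piece G V A" "piece G V' A'" "p \<in> V \<inter> V'" "q \<in> V \<inter> V'" "p \<noteq> q"
  shows "piece G (V \<union> V') (A \<union> A')"
proof -
  have "biconnected (V \<union> V') (A \<union> A')"
  proof (rule biconnectedI)
    fix Z X x y
    assume Z: "\<And>z z'. z \<in> Z \<Longrightarrow> z' \<in> Z \<Longrightarrow> z = (z' :: 'a)"
      and h: "x \<in> V \<union> V'" "x \<in> X" "x \<notin> Z" "y \<in> V \<union> V'" "y \<notin> X" "y \<notin> Z"
    obtain g where g: "g \<in> V" "g \<in> V'" "g \<notin> Z" using assms(3-5) Z by blast
    have cross: "\<exists>s t. (s, t) \<in> A \<union> A' \<and> s \<in> X \<and> s \<notin> Z \<and> t \<notin> X \<and> t \<notin> Z"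
      if "u \<in> X" "u \<notin> Z" "w \<notin> X" "w \<notin> Z" "u \<in> V \<and> w \<in> V \<or> u \<in> V' \<and> w \<in> V'" for u w
      using that biconnectedD[of V A Z u X w] biconnectedD[of V' A' Z u X w] assms(1,2) Z
      unfolding piece_def by (metis Un_iff)
    show "\<exists>s t. (s, t) \<in> A \<union> A' \<and> s \<in> X \<and> s \<notin> Z \<and> t \<notin> X \<and> t \<notin> Z"
      using cross[of x g] cross[of g y] h g by (cases "g \<in> X") blast+
  qed
  then show ?thesis using assms(1,2) unfolding piece_def by (auto intro: sym_Un)
qed

context pair_graph
begin

text \<open>Deleting one end leaves nothing to separate. Hence every edge, even a bridge, lies in a
  block.\<close>

lemma piece_edge:
  assumes "(u, v) \<in> parcs G"
  shows "piece G {u, v} {(u, v), (v, u)}"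
proof -
  have "biconnected {u, v} {(u, v), (v, u)}" by (rule biconnectedI) blast
  then show ?thesis unfolding piece_def
    using assms arcs_symmetric wellformed' by (auto simp: sym_def)
qed

lemma ex_block_containing:
  assumes "piece G V A"
  shows "\<exists>B. block G B \<and> V \<subseteq> pverts B \<and> A \<subseteq> parcs B"
proof -
  let ?P = "\<lambda>(V', A'). piece G V' A' \<and> V \<subseteq> V' \<and> A \<subseteq> A'"
  \<comment> \<open>In a finite graph, a piece that maximises this count is maximal for
    inclusion.\<close>
  let ?f = "\<lambda>(V', A'). card V' + card A'"
  have fin: "finite V'" "finite A'" if "piece G V' A'" for V' A'
    using that pair_finite_verts pair_finite_arcs finite_subset unfolding piece_def by blast+
  have start: "?P (V, A)" using assms by simp
  have bound: "\<forall>y. ?P y \<longrightarrow> ?f y < Suc (card (pverts G) + card (parcs G))"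
    using pair_finite_verts pair_finite_arcs
    by (auto simp: piece_def less_Suc_eq_le intro!: add_mono card_mono)
  obtain M where M: "?P M" "\<forall>y. ?P y \<longrightarrow> ?f y \<le> ?f M"
    using ex_has_greatest_nat[OF start bound] by (elim exE conjE)
  obtain V\<^sub>1 A\<^sub>1 where M': "M = (V\<^sub>1, A\<^sub>1)" by (cases M)
  let ?B = "\<lparr>pverts = V\<^sub>1, parcs = A\<^sub>1\<rparr>"
  have "block G ?B"
    unfolding block_iff_max_piece[OF wf_digraph_axioms]
  proof (intro conjI allI impI)
    show "piece G (pverts ?B) (parcs ?B)" using M M' by simp
    fix V' A' assume p: "piece G V' A'" "pverts ?B \<subseteq> V'" "parcs ?B \<subseteq> A'"
    then have le: "card V' + card A' \<le> card V\<^sub>1 + card A\<^sub>1"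
      using M(1) M(2)[rule_format, of "(V', A')"] M' by auto
    have "card V\<^sub>1 \<le> card V'" "card A\<^sub>1 \<le> card A'" using p fin[OF p(1)] by (auto intro: card_mono)
    then have "card V\<^sub>1 = card V'" "card A\<^sub>1 = card A'" using le by auto
    then show "V' = pverts ?B" "A' = parcs ?B"
      using card_subset_eq[OF fin(1)[OF p(1)] p(2)] card_subset_eq[OF fin(2)[OF p(1)] p(3)] by simp_all
  qed
  then show ?thesis using M M' by (intro exI[of _ ?B]) auto
qed

lemma block_absorbs:
  assumes "block G B" "piece G V A" "p \<in> V \<inter> pverts B" "q \<in> V \<inter> pverts B" "p \<noteq> q"
  shows "V \<subseteq> pverts B" "A \<subseteq> parcs B"
proof -
  have B: "piece G (pverts B) (parcs B)"
    "\<And>V A. piece G V A \<Longrightarrow> pverts B \<subseteq> V \<Longrightarrow> parcs B \<subseteq> A \<Longrightarrow> V = pverts B \<and> A = parcs B"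
    using assms(1) unfolding block_iff_max_piece[OF wf_digraph_axioms] by auto
  have "piece G (pverts B \<union> V) (parcs B \<union> A)"
    by (rule piece_union[OF B(1) assms(2)]) (use assms in auto)
  then have "pverts B \<union> V = pverts B \<and> parcs B \<union> A = parcs B" by (intro B(2)) auto
  then show "V \<subseteq> pverts B" "A \<subseteq> parcs B" by auto
qed

text \<open>The edge is itself a piece and shares both of its ends with the block.\<close>

lemma block_induced:
  assumes "block G B" "(u, v) \<in> parcs G" "u \<in> pverts B" "v \<in> pverts B"
  shows "(u, v) \<in> parcs B"
  using block_absorbs(2)[OF assms(1) piece_edge[OF assms(2)], of u v] assms no_loops'[of u v] by auto

end

section \<open>Biconnectedness of cycles\<close>

lemma path_crossing:
  assumes "a \<le> (b :: nat)" "\<And>t. a \<le> t \<Longrightarrow> t < b \<Longrightarrow> (c t, c (Suc t)) \<in> A" "c a \<in> X" "c b \<notin> X"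
  shows "\<exists>t. a \<le> t \<and> t < b \<and> (c t, c (Suc t)) \<in> A \<and> c t \<in> X \<and> c (Suc t) \<notin> X"
proof (rule ccontr)
  assume no: "\<not> ?thesis"
  have "t \<le> b \<longrightarrow> c t \<in> X" if "a \<le> t" for t
    using that
  proof (induction t rule: dec_induct)
    case (step t)
    then show ?case using no assms(2) by auto
  qed (use assms in simp)
  then show False using assms by blast
qed

lemma biconnected_cycle:
  assumes edge: "\<And>t. t < n \<Longrightarrow> (c t, c (Suc t)) \<in> A" and closing: "(c n, c 0) \<in> A" and sym: "sym A"
    and inj: "inj_on c {..n}"
  shows "biconnected (c ` {..n}) A"
proof (rule biconnectedI)
  fix Z X x y
  assume Z: "\<And>z z'. z \<in> Z \<Longrightarrow> z' \<in> Z \<Longrightarrow> z = z'"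
    and h: "x \<in> c ` {..n}" "x \<in> X" "x \<notin> Z" "y \<in> c ` {..n}" "y \<notin> X" "y \<notin> Z"
  have *: "\<exists>p q. (p, q) \<in> A \<and> p \<in> X \<and> p \<notin> Z \<and> q \<notin> X \<and> q \<notin> Z"
    if st: "s < t" "t \<le> n" "c s \<in> X" "c t \<notin> X" "c s \<notin> Z" "c t \<notin> Z" for s t X
  proof (cases "\<exists>u. s < u \<and> u < t \<and> c u \<in> Z")
    case False
    then have no: "c u \<notin> Z" if "s \<le> u" "u \<le> t" for u
      using that st by (metis le_neq_implies_less)
    obtain u where "s \<le> u" "u < t" "(c u, c (Suc u)) \<in> A" "c u \<in> X" "c (Suc u) \<notin> X"
      using path_crossing[of s t c A X] st edge by auto
    then show ?thesis using no[of u] no[of "Suc u"] by auto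
  next
    case True
    then obtain u where u: "s < u" "u < t" "c u \<in> Z" by blast
    have no: "c w \<notin> Z" if "w \<le> n" "w \<noteq> u" for w
      using that u st Z[of "c w" "c u"] inj_onD[OF inj, of w u] by auto
    \<comment> \<open>The deleted vertex lies between \<open>s\<close> and \<open>t\<close>, so the
      cycle is followed the other way: from \<open>c t\<close> up to \<open>c n\<close>, over the
      closing edge to \<open>c 0\<close>, and on to \<open>c s\<close>. Index \<open>n - t\<close>
      is the last one before the wrap, hence the further \<open>- 1\<close>.\<close>
    define d where "d i = c (if i \<le> n - t then t + i else i - (n - t) - 1)" for i
    let ?m = "n - t + 1 + s"
    have step: "(d i, d (Suc i)) \<in> A" if "i < ?m" for i
    proof -
      consider "i < n - t" | "i = n - t" | "n - t < i" by linarith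
      then show ?thesis
      proof cases
        case 1
        then show ?thesis using edge[of "t + i"] st by (simp add: d_def)
      next
        case 2
        then show ?thesis using closing st by (simp add: d_def)
      next
        case 3
        then have "i - (n - t) - 1 < n" using that st by simp
        moreover have "Suc (i - (n - t) - 1) = Suc i - (n - t) - 1" using 3 by simp
        ultimately show ?thesis using edge[of "i - (n - t) - 1"] 3 by (simp add: d_def)
      qed
    qed
    have dZ: "d i \<notin> Z" if "i \<le> ?m" for i
      unfolding d_def by (rule no) (use that st u in auto)
    have "d 0 = c t" "d ?m = c s" using st by (auto simp: d_def)
    \<comment> \<open>The detour runs from outside \<open>X\<close> into \<open>X\<close>; the
      crossing is found for the complement and reversed by symmetry of \<open>A\<close>.\<close>
    then obtain i where "i < ?m" "(d i, d (Suc i)) \<in> A" "d i \<in> - X" "d (Suc i) \<notin> - X"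
      using path_crossing[of 0 ?m d A "- X"] step st by auto
    then show ?thesis using dZ[of i] dZ[of "Suc i"] sym by (auto elim!: symE)
  qed
  obtain s t where st: "s \<le> n" "t \<le> n" "x = c s" "y = c t" using h by auto
  then consider "s < t" | "t < s" using h by (metis linorder_neqE_nat)
  then show "\<exists>p q. (p, q) \<in> A \<and> p \<in> X \<and> p \<notin> Z \<and> q \<notin> X \<and> q \<notin> Z"
  proof cases
    case 1
    then show ?thesis using *[of s t X] st h by blast
  next
    case 2
    then obtain p q where "(p, q) \<in> A" "p \<notin> X" "p \<notin> Z" "q \<in> X" "q \<notin> Z"
      using *[of t s "- X"] st h by auto
    then show ?thesis using sym by (meson symE)
  qed
qed

section \<open>Bearing trees with disjoint stems\<close>

lemma nth_pawalk_verts_0: "pawalk_verts u p ! 0 = u" if "pcas u p v"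
  using that by (cases p) auto

lemma nth_pawalk_verts_arc:
  assumes "pcas u p v" "a < length p"
  shows "p ! a = (pawalk_verts u p ! a, pawalk_verts u p ! Suc a)"
  using assms
proof (induction p arbitrary: u a)
  case (Cons e p)
  show ?case
  proof (cases a)
    case 0
    then show ?thesis using Cons.prems nth_pawalk_verts_0[of "snd e" p v] by (cases e) auto
  qed (use Cons in auto)
qed simp

lemma length_pawalk_verts: "length (pawalk_verts u p) = Suc (length p)"
  by (induction p arbitrary: u) auto

lemma nth_pawalk_verts_last: "pcas u p v \<Longrightarrow> pawalk_verts u p ! length p = v"
  by (induction p arbitrary: u) auto

lemma path_edges_nth:
  assumes "pcas u p v"
  shows "path_edges p = {{pawalk_verts u p ! a, pawalk_verts u p ! Suc a} | a. a < length p}"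
proof -
  have "set p = {(pawalk_verts u p ! a, pawalk_verts u p ! Suc a) | a. a < length p}"
    using nth_pawalk_verts_arc[OF assms] by (auto simp: set_conv_nth) metis+
  then show ?thesis unfolding path_edges_def by auto
qed

section \<open>Shortest walks, geodesics and relation powers\<close>

context pair_wf_digraph
begin

lemma awalk_take_nth:
  assumes "awalk u p v" "a \<le> length p"
  shows "awalk u (take a p) (pawalk_verts u p ! a)" "awalk (pawalk_verts u p ! a) (drop a p) v"
proof -
  have "awalk u (take a p) (pawalk_verts u p ! a) \<and> awalk (pawalk_verts u p ! a) (drop a p) v"
    using assms
  proof (induction p arbitrary: u a)
    case Nil
    then show ?case by (auto simp: awalk_Nil_iff)
  next
    case (Cons e p)
    then have "awalk (snd e) p v" "e \<in> parcs G" "fst e = u" "u \<in> pverts G"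
      by (auto simp: awalk_Cons_iff arc_fst_in_verts)
    then show ?case using Cons by (cases a) (auto simp: awalk_Cons_iff awalk_Nil_iff)
  qed
  then show "awalk u (take a p) (pawalk_verts u p ! a)" "awalk (pawalk_verts u p ! a) (drop a p) v"
    by auto
qed

text \<open>A shorter walk to an intermediate vertex, continued by the rest of \<open>p\<close>,
  would beat the shortest walk.\<close>

lemma gdist_along_shortest:
  assumes "awalk u p v" "length p = gdist G u v" "a \<le> length p"
  shows "gdist G u (pawalk_verts u p ! a) = a"
proof -
  note w = awalk_take_nth[OF assms(1,3)]
  obtain q where q: "apath u q (pawalk_verts u p ! a)" "length q = gdist G u (pawalk_verts u p ! a)"
    using gdist_attained[OF w(1)] by blast
  have "awalk u (q @ drop a p) v"
    using q(1) w(2) by (auto simp: apath_def)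
  from gdist_le[OF this] gdist_le[OF w(1)] show ?thesis using q(2) assms(2,3) by simp
qed

lemma shortest_awalk_imp_apath:
  assumes "awalk u p v" "length p = gdist G u v"
  shows "apath u p v"
proof -
  have "distinct (pawalk_verts u p)"
    unfolding distinct_conv_nth
  proof (intro allI impI)
    fix a b assume "a < length (pawalk_verts u p)" "b < length (pawalk_verts u p)" "a \<noteq> b"
    then show "pawalk_verts u p ! a \<noteq> pawalk_verts u p ! b"
      using gdist_along_shortest[OF assms, of a] gdist_along_shortest[OF assms, of b]
      by (auto simp: length_pawalk_verts)
  qed
  then show ?thesis using assms(1) by (simp add: apath_def)
qed

text \<open>Geodesics are compared with paths only; as shortest walks repeat no vertex, comparison
  with all walks gives the same, and walks are what relation powers describe.\<close>

lemma geodesic_iff: "geodesic G u p v \<longleftrightarrow> awalk u p v \<and> length p = gdist G u v"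
proof
  assume g: "geodesic G u p v"
  then have w: "awalk u p v" by (simp add: geodesic_def apath_def)
  then show "awalk u p v \<and> length p = gdist G u v"
    using gdist_attained[OF w] gdist_le[OF w] g unfolding geodesic_def by force
next
  assume "awalk u p v \<and> length p = gdist G u v"
  then show "geodesic G u p v" unfolding geodesic_def
    using shortest_awalk_imp_apath gdist_le by (auto simp: apath_def)
qed

lemma awalk_imp_relpow: "awalk u p v \<Longrightarrow> (u, v) \<in> parcs G ^^ length p"
proof (induction p arbitrary: u)
  case (Cons e p)
  then have "(u, snd e) \<in> parcs G" "(snd e, v) \<in> parcs G ^^ length p"
    by (cases e, auto simp: awalk_Cons_iff)
  then show ?case by (auto intro: relpow_Suc_I2 simp del: relpow.simps)
qed (simp add: awalk_Nil_iff)

lemma relpow_imp_awalk: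
  "(u, v) \<in> parcs G ^^ n \<Longrightarrow> u \<in> pverts G \<Longrightarrow> \<exists>p. awalk u p v \<and> length p = n"
proof (induction n arbitrary: u)
  case 0
  then show ?case by (auto simp: awalk_Nil_iff)
next
  case (Suc n)
  then obtain w where w: "(u, w) \<in> parcs G" "(w, v) \<in> parcs G ^^ n" by (meson relpow_Suc_D2)
  then obtain p where "awalk w p v" "length p = n" using Suc.IH in_arcsD2 by blast
  then show ?case using w Suc.prems by (intro exI[of _ "(u, w) # p"]) (auto simp: awalk_Cons_iff)
qed

lemma gdist_arc_le:
  assumes "awalk r p u" "(u, v) \<in> parcs G"
  shows "gdist G r v \<le> Suc (gdist G r u)"
proof -
  obtain q where q: "apath r q u" "length q = gdist G r u" using gdist_attained[OF assms(1)] by blast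
  have "awalk r (q @ [(u, v)]) v"
    using q(1) assms(2) by (auto simp: apath_def awalk_simps in_arcsD1 in_arcsD2)
  from gdist_le[OF this] show ?thesis using q by simp
qed

end

lemma (in pair_graph) connected_imp_awalk:
  assumes "connected G" "u \<in> pverts G" "v \<in> pverts G"
  shows "\<exists>p. awalk u p v"
proof -
  have "u \<rightarrow>\<^sup>*\<^bsub>with_proj G\<^esub> v"
    using assms reachable_mk_symmetric_eq[OF pair_sym_arcs]
    by (simp add: connected_def strongly_connected_def)
  then show ?thesis by (simp add: reachable_awalk)
qed

lemma (in pair_graph) geodetic_iff_unique_geodesics:
  assumes "connected G"
  shows "geodetic G \<longleftrightarrow> unique_geodesics (parcs G)"
proof
  assume geo: "geodetic G"
  show "unique_geodesics (parcs G)"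
    unfolding unique_geodesics_def
  proof (intro allI impI, elim conjE)
    fix u w w' v n
    assume h: "(u, w) \<in> parcs G" "(u, w') \<in> parcs G" "w \<noteq> w'" "(w, v) \<in> parcs G ^^ n" "(w', v) \<in> parcs G ^^ n"
    obtain p p' where p: "awalk w p v" "length p = n" "awalk w' p' v" "length p' = n"
      using relpow_imp_awalk h in_arcsD2 by metis
    have uv: "u \<in> pverts G" "v \<in> pverts G" using h in_arcsD1 p by auto
    have walks: "awalk u ((u, w) # p) v" "awalk u ((u, w') # p') v"
      using p h by (auto simp: awalk_Cons_iff)
    have "gdist G u v \<noteq> Suc n"
    proof
      assume "gdist G u v = Suc n"
      then have "geodesic G u ((u, w) # p) v" "geodesic G u ((u, w') # p') v"
        unfolding geodesic_iff using walks p by auto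
      then show False using geo uv h(3) unfolding geodetic_def by blast
    qed
    moreover have "gdist G u v \<le> Suc n" using gdist_le[OF walks(1)] p by simp
    moreover obtain q where "apath u q v" "length q = gdist G u v" using gdist_attained[OF walks(1)] by blast
    ultimately show "\<exists>m \<le> n. (u, v) \<in> parcs G ^^ m"
      using awalk_imp_relpow[of u q v] by (intro exI[of _ "gdist G u v"]) (auto simp: apath_def)
  qed
next
  assume ug: "unique_geodesics (parcs G)"
  have unique: "p = q"
    if "awalk u p v" "awalk u q v" "length p = gdist G u v" "length q = gdist G u v" for u p q v
    using that
  proof (induction p arbitrary: u q)
    case (Cons e p)
    then obtain e' q' where q: "q = e' # q'" by (cases q) auto
    have 1: "(u, snd e) \<in> parcs G" "(u, snd e') \<in> parcs G" "awalk (snd e) p v" "awalk (snd e') q' v"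
      "fst e = u" "fst e' = u" "length p = length q'"
      using Cons.prems q by (cases e, cases e', auto simp: awalk_Cons_iff)+
    have same: "snd e = snd e'"
    proof (rule ccontr)
      assume "snd e \<noteq> snd e'"
      then obtain m where m: "m \<le> length p" "(u, v) \<in> parcs G ^^ m"
        using unique_geodesicsD[OF ug 1(1,2)] awalk_imp_relpow 1 by metis
      then obtain x where "awalk u x v" "length x = m" using relpow_imp_awalk 1 in_arcsD1 by metis
      then show False using gdist_le[of u x v] m Cons.prems by simp
    qed
    \<comment> \<open>A shorter walk from \<open>snd e\<close> would shorten the whole walk, so the
      tail is shortest as well and the induction hypothesis applies.\<close>
    obtain x where x: "apath (snd e) x v" "length x = gdist G (snd e) v"
      using gdist_attained[OF 1(3)] by blast
    then have "awalk u ((u, snd e) # x) v" using 1 by (auto simp: awalk_Cons_iff apath_def)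
    from gdist_le[OF this] have "length p = gdist G (snd e) v"
      using x gdist_le[OF 1(3)] Cons.prems(3) by simp
    then have "p = q'" using Cons.IH[of "snd e" q'] 1 same by simp
    then show ?case using q same 1 by (simp add: prod_eq_iff)
  qed simp
  show "geodetic G"
    unfolding geodetic_def geodesic_iff
  proof (intro ballI)
    fix u v assume "u \<in> pverts G" "v \<in> pverts G"
    then obtain p where "awalk u p v" using connected_imp_awalk[OF assms] by blast
    then obtain q where "apath u q v" "length q = gdist G u v" using gdist_attained by blast
    then show "\<exists>!p. awalk u p v \<and> length p = gdist G u v"
      using unique by (intro ex1I[of _ q]) (auto simp: apath_def)
  qed
qed

section \<open>The stems of the bearing tree as legs of a spider\<close>

locale stem_disjoint_bearing_tree =
  fixes G T :: "'a pair_pre_digraph" and r :: 'a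
  assumes graph: "pair_graph G" and conn: "connected G" and root: "r \<in> pverts G"
    and bearing: "bearing_tree G r T"
    and disjoint: "\<And>s s'. stem T r s \<Longrightarrow> stem T r s' \<Longrightarrow> s \<noteq> s' \<Longrightarrow>
           set (pawalk_verts r s) \<inter> set (pawalk_verts r s') = {r}"
begin

sublocale G: pair_graph G by (rule graph)

sublocale T: pair_graph T using bearing by (auto simp: bearing_tree_def undirected_tree_def)

lemma T_verts: "pverts T = pverts G" and T_arcs: "parcs T \<subseteq> parcs G"
  using bearing by (auto simp: bearing_tree_def spanning_def subgraph_def)

lemma T_connected: "connected T"
  using bearing by (simp add: bearing_tree_def undirected_tree_def)

lemma gdist_T: "v \<in> pverts G \<Longrightarrow> gdist T r v = gdist G r v"
  using bearing_tree_gdist[OF graph bearing] .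

text \<open>Among the ends of shortest walks from \<open>r\<close> through \<open>v\<close>, one
  farthest from the root is a leaf, since a child farther away would extend the walk.\<close>

lemma shortest_stem_through:
  assumes "v \<in> pverts G"
  obtains s w where "T.awalk r s w" "length s = gdist T r w" "leaf T r w" "v \<in> set (pawalk_verts r s)"
proof -
  let ?P = "\<lambda>w. \<exists>s. T.awalk r s w \<and> length s = gdist T r w \<and> v \<in> set (pawalk_verts r s)"
  obtain p where "T.awalk r p v" using T.connected_imp_awalk[OF T_connected] assms root T_verts by blast
  then obtain q where q: "T.apath r q v" "length q = gdist T r v" using T.gdist_attained by blast
  then have "v = pawalk_verts r q ! length q"
    using nth_pawalk_verts_last[of r q v] by (simp add: T.apath_def T.awalk_def)
  then have "v \<in> set (pawalk_verts r q)" by (metis length_pawalk_verts lessI nth_mem)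
  then have ex: "?P v" using q by (auto simp: T.apath_def)
  have fin: "finite {w. ?P w}"
    by (rule finite_subset[OF _ T.pair_finite_verts]) auto
  let ?m = "Max (gdist T r ` {w. ?P w})"
  have "?m \<in> gdist T r ` {w. ?P w}" using fin ex by (intro Max_in) auto
  then obtain w where w: "gdist T r w = ?m" "w \<in> {w. ?P w}" by (elim imageE) (rule that[OF sym])
  have max: "gdist T r w' \<le> gdist T r w" if "?P w'" for w'
    unfolding w(1) by (rule Max_ge) (use fin that in auto)
  obtain s where s: "T.awalk r s w" "length s = gdist T r w" "v \<in> set (pawalk_verts r s)" using w(2) by blast
  have "leaf T r w"
    unfolding leaf_def
  proof (intro conjI notI)
    show "w \<in> pverts T" using s by auto
    assume "\<exists>w'. (w, w') \<in> parcs T \<and> gdist T r w < gdist T r w'"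
    then obtain w' where w': "(w, w') \<in> parcs T" "gdist T r w < gdist T r w'" by blast
    let ?s = "s @ [(w, w')]"
    have "T.awalk r ?s w'"
      using s(1) w'(1) by (auto simp: T.awalk_simps T.in_arcsD1 T.in_arcsD2)
    moreover have "length ?s = gdist T r w'" using T.gdist_arc_le[OF s(1) w'(1)] w'(2) s(2) by simp
    moreover have "v \<in> set (pawalk_verts r ?s)"
    proof -
      have "set (pawalk_verts u p) \<subseteq> set (pawalk_verts u (p @ [(w, w')]))" if "pcas u p w" for u p
        using that by (induction p arbitrary: u) auto
      from this[of r s] show ?thesis using s unfolding T.awalk_def by auto
    qed
    ultimately have "?P w'" by blast
    then have "gdist T r w' \<le> gdist T r w" by (rule max)
    then show False using w'(2) by simp
  qed
  then show ?thesis using that s by blast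
qed

text \<open>By definition a stem is some path to a leaf. A shortest stem through this leaf meets it
  there, so disjointness makes the two equal, unless the leaf is the root and the stem is
  empty.\<close>

lemma stem_iff: "stem T r s \<longleftrightarrow> (\<exists>v. leaf T r v \<and> T.awalk r s v \<and> length s = gdist T r v)"
proof
  assume "stem T r s"
  then obtain v where v: "leaf T r v" "T.apath r s v" by (auto simp: stem_def)
  have vs: "v \<in> set (pawalk_verts r s)"
    using v(2) nth_pawalk_verts_last[of r s v] length_pawalk_verts[of r s]
    by (metis T.apath_def T.awalk_def lessI nth_mem)
  have "v \<in> pverts G" using v(1) T_verts by (auto simp: leaf_def)
  then obtain p w where p: "T.awalk r p w" "length p = gdist T r w" "leaf T r w" "v \<in> set (pawalk_verts r p)"
    by (rule shortest_stem_through)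
  then have "stem T r p" using T.shortest_awalk_imp_apath by (auto simp: stem_def)
  show "\<exists>v. leaf T r v \<and> T.awalk r s v \<and> length s = gdist T r v"
  proof (cases "s = p")
    case False
    then have "v = r" using disjoint[OF \<open>stem T r s\<close> \<open>stem T r p\<close>] vs p(4) by auto
    then have "s = []" using v(2) by (metis T.apath_ends)
    moreover have "gdist T r r \<le> 0" using T.gdist_le[of r "[]" r] v \<open>v = r\<close> \<open>s = []\<close> by (auto simp: T.apath_def)
    ultimately show ?thesis using v \<open>v = r\<close> by (intro exI[of _ r]) (auto simp: T.apath_def)
  qed (use p in blast)
next
  assume "\<exists>v. leaf T r v \<and> T.awalk r s v \<and> length s = gdist T r v"
  then show "stem T r s" using T.shortest_awalk_imp_apath by (auto simp: stem_def)
qed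

lemma gdist_stem:
  assumes "stem T r s" "a \<le> length s"
  shows "gdist G r (pawalk_verts r s ! a) = a" "pawalk_verts r s ! a \<in> pverts G"
proof -
  obtain v where s: "T.awalk r s v" "length s = gdist T r v" using assms(1) stem_iff by blast
  show v: "pawalk_verts r s ! a \<in> pverts G"
    using T.awalk_take_nth(1)[OF s(1) assms(2)] T_verts by (auto dest: T.awalk_last_in_verts)
  show "gdist G r (pawalk_verts r s ! a) = a"
    using T.gdist_along_shortest[OF s assms(2)] gdist_T[OF v] by simp
qed

lemma stem_pcas: "stem T r s \<Longrightarrow> \<exists>v. pcas r s v"
  by (auto simp: stem_def T.apath_def T.awalk_def)

lemma stem_start: "stem T r s \<Longrightarrow> pawalk_verts r s ! 0 = r"
  using stem_pcas[of s] nth_pawalk_verts_0[of r s] by auto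

text \<open>The position on a stem is the distance from \<open>r\<close> in \<open>G\<close>,
  because breadth-first search preserves distances. Hence equal points have equal positions, and an
  edge of \<open>G\<close> raises the position by at most one.\<close>

sublocale spider "{s. stem T r s}" length "\<lambda>s a. pawalk_verts r s ! a" r "parcs G"
proof
  have "{s. stem T r s} \<subseteq> (\<Union>v \<in> pverts T. {p. T.apath r p v})" by (auto simp: stem_def leaf_def)
  then show "finite {s. stem T r s}"
    by (rule finite_subset) (use T.pair_finite_verts T.apaths_finite in auto)
next
  fix s assume "s \<in> {s. stem T r s}"
  then show "pawalk_verts r s ! 0 = r" by (simp add: stem_start)
next
  fix s s' a b
  assume h: "s \<in> {s. stem T r s}" "s' \<in> {s. stem T r s}" "a \<le> length s" "b \<le> length s'" "0 < a"
    "pawalk_verts r s ! a = pawalk_verts r s' ! b"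
  then have ab: "a = b" using gdist_stem[of s a] gdist_stem[of s' b] by auto
  have "s = s'"
  proof (rule ccontr)
    assume "s \<noteq> s'"
    moreover have "pawalk_verts r s ! a \<in> set (pawalk_verts r s) \<inter> set (pawalk_verts r s')"
      using h by (metis IntI le_imp_less_Suc length_pawalk_verts nth_mem)
    ultimately have "pawalk_verts r s ! a = r" using disjoint h by auto
    moreover have "pawalk_verts r s ! 0 = r" using h by (simp add: stem_start)
    ultimately show False using gdist_stem[of s a] gdist_stem[of s 0] h by auto
  qed
  then show "s = s' \<and> a = b" using ab by simp
next
  fix s a assume h: "s \<in> {s. stem T r s}" "a < length s"
  then obtain v where "T.awalk r s v" by (auto simp: stem_def T.apath_def)
  then have "s ! a \<in> parcs T" "s ! a = (pawalk_verts r s ! a, pawalk_verts r s ! Suc a)"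
    using h nth_pawalk_verts_arc[of r s v a] nth_mem[of a s] unfolding T.awalk_def by auto
  then show "(pawalk_verts r s ! a, pawalk_verts r s ! Suc a) \<in> parcs G" using T_arcs by auto
next
  fix u v assume "(u, v) \<in> parcs G"
  then show "(v, u) \<in> parcs G" by (rule G.arcs_symmetric)
next
  fix u show "(u, u) \<notin> parcs G" using G.no_loops' by blast
next
  fix u v assume "(u, v) \<in> parcs G"
  then have "u \<in> pverts G" by (rule G.in_arcsD1)
  then obtain s w where s: "T.awalk r s w" "length s = gdist T r w" "leaf T r w"
    and u: "u \<in> set (pawalk_verts r s)" by (rule shortest_stem_through)
  have "s \<in> {s. stem T r s}" using stem_iff s by blast
  moreover obtain a where "a \<le> length s" "u = pawalk_verts r s ! a"
    using u by (auto simp: in_set_conv_nth length_pawalk_verts less_Suc_eq_le)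
  ultimately show "\<exists>s \<in> {s. stem T r s}. \<exists>a \<le> length s. u = pawalk_verts r s ! a" by blast
next
  fix s s' a b
  assume h: "s \<in> {s. stem T r s}" "s' \<in> {s. stem T r s}" "a \<le> length s" "b \<le> length s'"
    "(pawalk_verts r s ! a, pawalk_verts r s' ! b) \<in> parcs G"
  have "pawalk_verts r s ! a \<in> pverts G" using h gdist_stem by blast
  then obtain p where "G.awalk r p (pawalk_verts r s ! a)" using G.connected_imp_awalk[OF conn root] by blast
  from G.gdist_arc_le[OF this h(5)] show "b \<le> Suc a"
    using gdist_stem[of s a] gdist_stem[of s' b] h by simp
qed

end

section \<open>Transversal blocks\<close>

context spider
begin

lemma biconnected_balk_cycle:
  assumes balk_at: "balk_at i j a"
  defines "V \<equiv> pt i ` {..a} \<union> pt j ` {..a}"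
  shows "biconnected V (E \<inter> V \<times> V)"
proof -
  \<comment> \<open>Up stem \<open>i\<close> from the root to tier \<open>a\<close>, across the
    balk, and down stem \<open>j\<close> from tier \<open>a\<close> to tier 1. These are
    \<open>2 * a + 1\<close> vertices, the root only once; the edge from \<open>pt j 1\<close> to
    the root closes the cycle.\<close>
  define c where "c t = (if t \<le> a then pt i t else pt j (2 * a + 1 - t))" for t
  from balk_at have h: "i \<in> S" "j \<in> S" "i \<noteq> j" "a \<le> len i" "a \<le> len j" "(pt i a, pt j a) \<in> E" "0 < a"
    using balk_at_pos by (auto simp: balk_at_def)
  have cV: "c t \<in> V" if "t \<le> 2 * a" for t
    using that by (auto simp: c_def V_def)
  have "V \<subseteq> c ` {..2 * a}"
  proof
    fix x assume "x \<in> V"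
    then consider t where "t \<le> a" "x = pt i t" | t where "0 < t" "t \<le> a" "x = pt j t" | "x = pt j 0"
      unfolding V_def by (auto simp: gr0_conv_Suc) (metis not0_implies_Suc)
    then show "x \<in> c ` {..2 * a}"
    proof cases
      case (1 t)
      then show ?thesis by (intro image_eqI[of _ _ t]) (auto simp: c_def)
    next
      case (2 t)
      then show ?thesis by (intro image_eqI[of _ _ "2 * a + 1 - t"]) (auto simp: c_def)
    next
      case 3
      then show ?thesis using h pt_0 by (intro image_eqI[of _ _ 0]) (auto simp: c_def)
    qed
  qed
  then have V: "V = c ` {..2 * a}" using cV by auto
  have edge: "(c t, c (Suc t)) \<in> E" if "t < 2 * a" for t
  proof -
    consider "t < a" | "t = a" | "a < t" by linarith
    then show ?thesis
    proof cases
      case 1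
      then show ?thesis using stem_edge[of i t] h by (simp add: c_def)
    next
      case 2
      then show ?thesis using h by (simp add: c_def)
    next
      case 3
      then have "2 * a + 1 - t = Suc (2 * a - t)" using that by simp
      then show ?thesis using 3 that E_sym[OF stem_edge[of j "2 * a - t"]] h by (simp add: c_def)
    qed
  qed
  have closing: "(c (2 * a), c 0) \<in> E"
    using E_sym[OF stem_edge[of j 0]] h pt_0 by (simp add: c_def)
  have inj: "inj_on c {..2 * a}"
  proof (rule inj_onI)
    fix s t assume st: "s \<in> {..2 * a}" "t \<in> {..2 * a}" "c s = c t"
    then show "s = t"
      using h pt_eq_iff[of i i s t] pt_eq_iff[of i j s "2 * a + 1 - t"] pt_eq_iff[of j i "2 * a + 1 - s" t]
        pt_eq_iff[of j j "2 * a + 1 - s" "2 * a + 1 - t"]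
      by (auto simp: c_def split: if_splits)
  qed
  show ?thesis
    unfolding V
  proof (rule biconnected_cycle[OF _ _ _ inj])
    show "sym (E \<inter> c ` {..2 * a} \<times> c ` {..2 * a})" using E_sym by (auto simp: sym_def)
  qed (use edge closing in auto)
qed

lemma adjacent_tiers:
  assumes "i \<in> S" "a \<le> len i" "b \<le> len i" "(pt i a, pt i b) \<in> E"
  shows "b = Suc a \<or> a = Suc b"
proof -
  have "b \<le> Suc a" "a \<le> Suc b" using E_tier[of i i a b] E_tier[of i i b a] E_sym assms by auto
  moreover have "a \<noteq> b" using assms E_irrefl by metis
  ultimately show ?thesis by linarith
qed

end

context stem_disjoint_bearing_tree
begin

abbreviation vt :: "('a \<times> 'a) awalk \<Rightarrow> nat \<Rightarrow> 'a" where
  "vt s a \<equiv> pawalk_verts r s ! a"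

lemma set_stem_verts: "set (pawalk_verts r s) = vt s ` {..length s}"
  by (auto simp: set_conv_nth length_pawalk_verts less_Suc_eq_le)

lemma path_edges_stem:
  assumes "stem T r s"
  shows "path_edges s = {{vt s a, vt s (Suc a)} | a. a < length s}"
proof -
  obtain v where "pcas r s v" using stem_pcas[OF assms] by blast
  then show ?thesis by (rule path_edges_nth)
qed

lemma vt_in_tier_iff:
  assumes "stem T r s" "a \<le> length s"
  shows "vt s a \<in> tier G r j \<longleftrightarrow> j = a"
  using gdist_stem[OF assms] by (auto simp: tier_def)

lemma vt_eq_iff:
  assumes "stem T r s" "stem T r s'" "a \<le> length s" "b \<le> length s'"
  shows "vt s a = vt s' b \<longleftrightarrow> a = b \<and> (s = s' \<or> a = 0)"
  using pt_eq_iff[of s s' a b] assms by simp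

lemma edges_up_to_stem:
  assumes "stem T r s"
  shows "edges_up_to G r k s = (\<lambda>a. {vt s a, vt s (Suc a)}) ` {..<min k (length s)}"
proof -
  have "{vt s a, vt s (Suc a)} \<subseteq> (\<Union>j \<le> k. tier G r j) \<longleftrightarrow> a < k" if "a < length s" for a
    using that vt_in_tier_iff[OF assms, of a] vt_in_tier_iff[OF assms, of "Suc a"] by auto
  then have "edges_up_to G r k s = {e. \<exists>a < length s. e = {vt s a, vt s (Suc a)} \<and> a < k}"
    unfolding edges_up_to_def path_edges_stem[OF assms] by blast
  then show ?thesis by auto
qed

text \<open>Turns the condition of \<open>transversal\<close> that a stem contributes
  \<open>k\<close> edges into \<open>k \<le> length s\<close>.\<close>

lemma card_edges_up_to_stem:
  assumes "stem T r s"
  shows "card (edges_up_to G r k s) = min k (length s)"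
proof -
  have "inj_on (\<lambda>a. {vt s a, vt s (Suc a)}) {..<min k (length s)}"
    by (rule inj_onI) (use vt_eq_iff[OF assms assms] in \<open>auto simp: doubleton_eq_iff\<close>)
  then show ?thesis unfolding edges_up_to_stem[OF assms] by (simp add: card_image)
qed

lemma balk_between_iff:
  assumes "stem T r s" "stem T r s'"
  shows "balk_between G r j s s' e \<longleftrightarrow> balk_at s s' j \<and> e = {vt s j, vt s' j}"
proof
  assume "balk_between G r j s s' e"
  then obtain x y where xy: "e = {x, y}" "x \<in> set (pawalk_verts r s) \<inter> tier G r j"
    "y \<in> set (pawalk_verts r s') \<inter> tier G r j" "e \<in> edges G"
    unfolding balk_between_def balk_def by blast
  then have "j \<le> length s" "j \<le> length s'" "x = vt s j" "y = vt s' j"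
    using vt_in_tier_iff assms unfolding set_stem_verts by auto
  moreover have "(x, y) \<in> parcs G" using xy E_sym by (auto simp: edges_def doubleton_eq_iff)
  moreover then have "s \<noteq> s'" using \<open>x = _\<close> \<open>y = _\<close> E_irrefl by auto
  ultimately show "balk_at s s' j \<and> e = {vt s j, vt s' j}" using xy assms by (auto simp: balk_at_def)
next
  assume b: "balk_at s s' j \<and> e = {vt s j, vt s' j}"
  then have "vt s j \<in> tier G r j" "vt s' j \<in> tier G r j" "e \<in> edges G"
    using vt_in_tier_iff assms by (auto simp: balk_at_def edges_def)
  then show "balk_between G r j s s' e"
    using b unfolding balk_between_def balk_def set_stem_verts by (auto simp: balk_at_def)
qed

lemma piece_balk_cycle:
  assumes "balk_at i j a"
  defines "V \<equiv> vt i ` {..a} \<union> vt j ` {..a}"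
  shows "piece G V (parcs G \<inter> V \<times> V)"
proof -
  have "V \<subseteq> pverts G" using assms gdist_stem(2) by (auto simp: balk_at_def V_def)
  then show ?thesis using biconnected_balk_cycle[OF assms(1)] E_sym
    unfolding V_def piece_def by (auto simp: sym_def)
qed

lemma block_piece:
  assumes "block G B"
  shows "piece G (pverts B) (parcs B)"
  using assms unfolding block_iff_max_piece[OF G.wf_digraph_axioms] by blast

text \<open>The cycle of any balk of \<open>i\<close> passes through the root and
  \<open>vt i 1\<close>, so it shares two vertices with a block that holds the first edge of the
  stem.\<close>

lemma block_absorbs_balk_cycle:
  assumes "block G B" "balk_at i j a" "r \<in> pverts B" "vt i 1 \<in> pverts B"
  shows "vt i ` {..a} \<union> vt j ` {..a} \<subseteq> pverts B" "(vt i a, vt j a) \<in> parcs B"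
proof -
  have s: "stem T r i" "stem T r j" "a \<le> length i" "a \<le> length j" "0 < a" "(vt i a, vt j a) \<in> parcs G"
    using assms(2) balk_at_pos by (auto simp: balk_at_def)
  then have 1: "r \<in> vt i ` {..a}" "vt i 1 \<in> vt i ` {..a}"
    using stem_start[of i] by (auto intro: image_eqI[of _ _ 0])
  have "vt i 1 \<noteq> vt i 0" using vt_eq_iff[of i i 1 0] s by auto
  then have "r \<noteq> vt i 1" using stem_start s by auto
  then show "vt i ` {..a} \<union> vt j ` {..a} \<subseteq> pverts B"
    by (intro G.block_absorbs(1)[OF assms(1) piece_balk_cycle[OF assms(2)], of r "vt i 1"]) (use 1 assms in auto)
  then show "(vt i a, vt j a) \<in> parcs B"
    by (intro G.block_induced[OF assms(1) s(6)]) auto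
qed

lemma stem_coords:
  assumes "v \<in> pverts G"
  obtains s a where "stem T r s" "a \<le> length s" "v = vt s a"
proof -
  obtain s w where s: "T.awalk r s w" "length s = gdist T r w" "leaf T r w"
    and v: "v \<in> set (pawalk_verts r s)" by (rule shortest_stem_through[OF assms])
  have "stem T r s" using s stem_iff by blast
  then show ?thesis using that v unfolding set_stem_verts by auto
qed

lemma block_graph:
  assumes "block G B"
  shows "pair_graph B" "subgraph B G" "connected B"
proof -
  have p: "piece G (pverts B) (parcs B)" by (rule block_piece[OF assms])
  show sub: "subgraph B G" "connected B"
    using assms unfolding block_def pre_digraph.max_subgraph_def by auto
  have fin: "finite (pverts B)" "finite (parcs B)"
    using p G.pair_finite_verts G.pair_finite_arcs finite_subset unfolding piece_def by blast+
  show "pair_graph B"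
    using p fin G.no_loops' by unfold_locales (auto simp: piece_def symmetric_def)
qed

section \<open>Blocks of a spider of stars are transversal\<close>

lemma starry_star:
  assumes "starry" "balk_at i j a"
  obtains C h k l where "i \<in> C" "star C h k l"
  using assms unfolding starry_def balk_at_def by blast

lemma star_balk_at_iff:
  assumes "star C h k l" "i \<in> C"
  shows "balk_at i m a \<longleftrightarrow> m \<in> C \<and> i \<noteq> m \<and> a = (if i = h \<or> m = h then k else l)"
  using assms unfolding star_def by blast

text \<open>Without balks the stems are connected only through the root, which is no cut vertex of a
  block. So deleting \<open>r\<close> confines the block to the stem of any of its other
  vertices.\<close>

lemma transversal_if_no_balk:
  assumes no: no_oblique and B: "block G B" and nb: "\<And>i j a. balk_at i j a \<Longrightarrow> (vt i a, vt j a) \<notin> parcs B"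
  shows "transversal G r T B"
proof -
  note p = block_piece[OF B]
  have pB: "biconnected (pverts B) (parcs B)" "pverts B \<subseteq> pverts G" "parcs B \<subseteq> parcs G"
    "parcs B \<subseteq> pverts B \<times> pverts B"
    using p unfolding piece_def by auto
  obtain s where s: "stem T r s" "pverts B \<subseteq> set (pawalk_verts r s)"
  proof (cases "pverts B \<subseteq> {r}")
    case True
    obtain s a where "stem T r s" using stem_coords[OF root] by blast
    moreover have "r \<in> set (pawalk_verts r s)"
      unfolding set_stem_verts using stem_start[OF calculation] by (auto intro: image_eqI[of _ _ 0])
    ultimately show ?thesis using that True by blast
  next
    case False
    then obtain v where v: "v \<in> pverts B" "v \<noteq> r" by blast
    then obtain s a where s: "stem T r s" "a \<le> length s" "v = vt s a" using stem_coords pB(2) by blast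
    have "pverts B \<subseteq> set (pawalk_verts r s)"
    proof
      fix w assume w: "w \<in> pverts B"
      show "w \<in> set (pawalk_verts r s)"
      proof (rule ccontr)
        assume nw: "w \<notin> set (pawalk_verts r s)"
        have "w \<noteq> r" using nw stem_start[OF s(1)] unfolding set_stem_verts by (metis atMost_iff imageI zero_le)
        moreover have "v \<in> set (pawalk_verts r s)" using s unfolding set_stem_verts by auto
        ultimately obtain p q where pq: "(p, q) \<in> parcs B" "p \<in> set (pawalk_verts r s)" "p \<noteq> r"
          "q \<notin> set (pawalk_verts r s)" "q \<noteq> r"
          using biconnected_avoiding[OF pB(1) v(1) _ v(2) w nw] by blast
        then obtain c where c: "c \<le> length s" "p = vt s c" unfolding set_stem_verts by auto
        have pos: "0 < c" using c pq(3) stem_start[OF s(1)] by (cases c) auto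
        have arc: "(vt s c, q) \<in> parcs G" using pq c pB by auto
        have "s \<in> {s. stem T r s}" using s by simp
        from no this pos c(1) arc show False
        proof (cases rule: neighbour_cases)
          case down
          then show ?thesis using pq(4) c unfolding set_stem_verts by auto
        next
          case up
          then show ?thesis using pq(4) c unfolding set_stem_verts by auto
        next
          case (balk m)
          then show ?thesis using nb[of s m c] pq c by auto
        qed
      qed
    qed
    then show ?thesis using that s by blast
  qed
  have "edges B \<subseteq> path_edges s"
  proof
    fix e assume "e \<in> edges B"
    then obtain u v where e: "e = {u, v}" "(u, v) \<in> parcs B" by (auto simp: edges_def)
    then have "u \<in> vt s ` {..length s}" "v \<in> vt s ` {..length s}"
      using s(2) pB(4) unfolding set_stem_verts by auto
    then obtain a b where ab: "u = vt s a" "v = vt s b" "a \<le> length s" "b \<le> length s" by auto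
    then have "b = Suc a \<or> a = Suc b" using adjacent_tiers[of s a b] s(1) e(2) pB(3) by auto
    then show "e \<in> path_edges s" unfolding path_edges_stem[OF s(1)] using e ab
      by (auto simp: insert_commute)
  qed
  then show ?thesis using s block_graph[OF B] unfolding transversal_def by blast
qed

text \<open>One balk brings its cycle into the block, hence the root and a first edge, and from
  there the cycles of all balks of the star. The converse inclusion deletes a single vertex, the
  root or the top of a cycle.\<close>

lemma block_of_star_verts:
  assumes st: "star C h k l" and no: no_oblique and B: "block G B"
    and i: "i \<in> C" "balk_at i j a" "(vt i a, vt j a) \<in> parcs B"
  shows "pverts B = (\<Union>m \<in> C. vt m ` {..k})" "0 < k" "\<forall>m \<in> C. k \<le> length m"
proof -
  note p = block_piece[OF B]
  have pB: "biconnected (pverts B) (parcs B)" "pverts B \<subseteq> pverts G" "parcs B \<subseteq> parcs G"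
    "parcs B \<subseteq> pverts B \<times> pverts B"
    using p unfolding piece_def by auto
  have CS: "stem T r m" if "m \<in> C" for m using that st unfolding star_def by auto
  have hC: "h \<in> C" and lk: "l \<le> k" using st unfolding star_def by auto
  note balk_at = star_balk_at_iff[OF st]
  have ij: "i \<noteq> j" "j \<in> C" "0 < a" "a \<le> length i" "a \<le> length j" "(vt i a, vt j a) \<in> parcs G"
    using balk_at[OF i(1), of j a] i(2) balk_at_pos[OF i(2)] unfolding balk_at_def by blast+
  have "pverts B \<inter> (vt i ` {..a} \<union> vt j ` {..a}) \<supseteq> {vt i a, vt j a}" "vt i a \<noteq> vt j a"
    using i(3) pB(4) G.no_loops' ij(6) by auto
  then have "vt i ` {..a} \<union> vt j ` {..a} \<subseteq> pverts B"
    by (intro G.block_absorbs(1)[OF B piece_balk_cycle[OF i(2)], of "vt i a" "vt j a"]) auto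
  then have "vt i 0 \<in> pverts B" and i1: "vt i 1 \<in> pverts B" using ij(3) by auto
  then have rB: "r \<in> pverts B" using stem_start[OF CS[OF i(1)]] by simp
  \<comment> \<open>Every other member has a balk with \<open>i\<close>, whose cycle contains the
    first vertex of that member.\<close>
  have first: "vt m 1 \<in> pverts B" if "m \<in> C" for m
  proof (cases "m = i")
    case False
    define x where "x = (if i = h \<or> m = h then k else l)"
    have x: "balk_at i m x" by (rule balk_at[OF i(1), THEN iffD2]) (use that False in \<open>simp add: x_def\<close>)
    have "vt m ` {..x} \<subseteq> pverts B" using block_absorbs_balk_cycle(1)[OF B x rB i1] by auto
    then show ?thesis using balk_at_pos[OF x] by auto
  qed (use i1 in simp)
  have hub: "vt m ` {..k} \<union> vt h ` {..k} \<subseteq> pverts B \<and> k \<le> length m \<and> k \<le> length h \<and> 0 < k"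
    if "m \<in> C" "m \<noteq> h" for m
  proof -
    have b: "balk_at m h k" using balk_at[OF that(1), of h k] that hC by simp
    then show ?thesis using block_absorbs_balk_cycle(1)[OF B b rB first[OF that(1)]] balk_at_pos[OF b]
      by (auto simp: balk_at_def)
  qed
  obtain m\<^sub>0 where "m\<^sub>0 \<in> C" "m\<^sub>0 \<noteq> h" using i ij by blast
  note m\<^sub>0 = hub[OF this]
  have sub: "vt m ` {..k} \<subseteq> pverts B" and len: "k \<le> length m" if "m \<in> C" for m
    using m\<^sub>0 hub[of m] that by (cases "m = h"; auto)+
  show k: "0 < k" and "\<forall>m \<in> C. k \<le> length m" using m\<^sub>0 len by auto
  have "v \<in> (\<Union>m \<in> C. vt m ` {..k})" if v: "v \<in> pverts B" for v
  proof -
    obtain m t where m: "stem T r m" "t \<le> length m" "v = vt m t" using stem_coords v pB(2) by blast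
    show ?thesis
    proof (cases "t = 0")
      case True
      then have "v = vt h 0" using m stem_start CS[OF hC] by simp
      then show ?thesis using hC by auto
    next
      case False
      have "m \<in> C"
      proof (rule ccontr)
        assume mC: "m \<notin> C"
        \<comment> \<open>With the root deleted, no edge leaves the stems of the star, because their
          balks lead back into the star.\<close>
        let ?X = "\<Union>c \<in> C. vt c ` {..length c}"
        have x: "vt i 1 \<in> ?X" "vt i 1 \<noteq> r"
          using i(1) ij vt_eq_iff[of i i 1 0] CS[OF i(1)] stem_start[of i] by (auto intro!: bexI[of _ i])
        have y: "v \<notin> ?X" "v \<noteq> r"
          using m False mC vt_eq_iff[OF m(1) CS m(2)] vt_eq_iff[OF m(1) m(1) m(2), of 0] stem_start[of m] by auto
        obtain p q where pq: "(p, q) \<in> parcs B" "p \<in> ?X" "p \<noteq> r" "q \<notin> ?X" "q \<noteq> r"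
          by (rule biconnected_avoiding[OF pB(1) i1 x v y])
        then obtain c d where c: "c \<in> C" "d \<le> length c" "p = vt c d" by auto
        have pos: "0 < d" using c pq(3) stem_start[OF CS[OF c(1)]] by (cases d) auto
        have arc: "(vt c d, q) \<in> parcs G" using pq c pB by auto
        have "c \<in> {s. stem T r s}" using c CS by simp
        from no this pos c(2) arc show False
        proof (cases rule: neighbour_cases)
          case down
          then show ?thesis using pq(4) c by auto
        next
          case up
          then show ?thesis using pq(4) c by auto
        next
          case (balk m)
          have "m \<in> C" using balk_at[OF c(1)] balk(1) by blast
          moreover have "d \<le> length m" using balk(1) by (simp add: balk_at_def)
          ultimately show ?thesis using pq(4) balk(2) by auto
        qed
      qed
      moreover have "t \<le> k"
      proof (rule ccontr)
        assume t: "\<not> t \<le> k"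
        \<comment> \<open>Above tier \<open>k\<close> the stem \<open>m\<close> has no balks, since
          \<open>l \<le> k\<close>; so its upper end hangs on \<open>vt m k\<close> alone.\<close>
        let ?X = "vt m ` {k<..length m}"
        have y: "r \<notin> ?X" "r \<noteq> vt m k" "v \<noteq> vt m k"
          using vt_eq_iff[OF m(1) m(1), of 0] vt_eq_iff[OF m(1) m(1) m(2), of k] stem_start[OF m(1)]
            len[OF \<open>m \<in> C\<close>] k t m by auto
        have "v \<in> ?X" using m t by auto
        then obtain p q where pq: "(p, q) \<in> parcs B" "p \<in> ?X" "p \<noteq> vt m k" "q \<notin> ?X" "q \<noteq> vt m k"
          by (rule biconnected_avoiding[OF pB(1) v _ y(3) rB y(1,2)])
        then obtain d where d: "k < d" "d \<le> length m" "p = vt m d" by auto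
        have arc: "m \<in> {s. stem T r s}" "0 < d" "(vt m d, q) \<in> parcs G" using d m pq pB by auto
        from no arc(1,2) d(2) arc(3) show False
        proof (cases rule: neighbour_cases)
          case down
          moreover have "k < d - 1 \<or> k = d - 1" using d by linarith
          ultimately show ?thesis using pq(4,5) d by auto
        next
          case up
          then show ?thesis using pq(4) d by auto
        next
          case (balk n)
          then show ?thesis using balk_at[OF \<open>m \<in> C\<close>, of n d] d lk by (auto split: if_splits)
        qed
      qed
      ultimately show ?thesis using m by auto
    qed
  qed
  then show "pverts B = (\<Union>m \<in> C. vt m ` {..k})" using sub by blast
qed

lemma transversal_if_balk:
  assumes st: "star C h k l" and no: no_oblique and B: "block G B"
    and i: "i \<in> C" "balk_at i j a" "(vt i a, vt j a) \<in> parcs B"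
  shows "transversal G r T B"
proof -
  note V = block_of_star_verts[OF assms]
  note balk_at = star_balk_at_iff[OF st]
  have pB: "parcs B \<subseteq> parcs G" "parcs B \<subseteq> pverts B \<times> pverts B"
    using block_piece[OF B] unfolding piece_def by auto
  have CS: "stem T r m" if "m \<in> C" for m using that st unfolding star_def by auto
  have hC: "h \<in> C" and lk: "l \<le> k" using st unfolding star_def by auto
  have "finite (C - {h})" using st finite_stems finite_subset unfolding star_def by blast
  \<comment> \<open>The definition of \<open>transversal\<close> reserves number 0 for the hub;
    \<open>f\<close> numbers the other stems from 1.\<close>
  then obtain f where f: "bij_betw f {1..card (C - {h})} (C - {h})" using ex_bij_betw_nat_finite_1 by blast
  define n where "n = card (C - {h})"
  define s where "s t = (if t = 0 then h else f t)" for t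
  have s0: "s 0 = h" by (simp add: s_def)
  have "s ` {1..n} = f ` {1..n}" by (rule image_cong) (auto simp: s_def)
  then have s_img: "s ` {1..n} = C - {h}" using bij_betw_imp_surj_on[OF f] by (simp add: n_def)
  have inj: "s t \<noteq> s u" if "1 \<le> t" "t < u" "u \<le> n" for t u
    using that inj_onD[OF bij_betw_imp_inj_on[OF f], of t u] by (auto simp: s_def n_def)
  have sC: "s t \<in> C" if "t \<le> n" for t
    using that s_img hC s0 by (cases "t = 0") (force simp: Suc_le_eq)+
  have sh: "s t \<noteq> h" if "1 \<le> t" "t \<le> n" for t using that s_img by force
  have idx: "\<exists>t \<le> n. m = s t" if "m \<in> C" for m
  proof (cases "m = h")
    case True
    then show ?thesis using s0 by auto
  next
    case False
    then have "m \<in> s ` {1..n}" using that s_img by simp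
    then show ?thesis by auto
  qed
  have C: "C = s ` {..n}" using sC idx by auto
  define b where "b t = {vt h k, vt (s t) k}" for t
  define c where "c t u = {vt (s t) l, vt (s u) l}" for t u
  have b: "balk_between G r k (s 0) (s t) (b t)" if "t \<in> {1..n}" for t
    unfolding s0 balk_between_iff[OF CS[OF hC] CS[OF sC[of t]]] b_def
    using that balk_at[OF hC, of "s t" k] sC[of t] sh[of t] balk_between_iff[OF CS[OF hC] CS[OF sC[of t]]] by auto
  have c: "balk_between G r l (s t) (s u) (c t u)" if "1 \<le> t" "t < u" "u \<le> n" for t u
    using that balk_between_iff[OF CS[OF sC[of t]] CS[OF sC[of u]]] balk_at[OF sC[of t], of "s u" l]
      sC[of u] inj[of t u] sh[of t] sh[of u] unfolding c_def by auto
  let ?R = "(\<Union>t \<le> n. edges_up_to G r k (s t)) \<union> {b t | t. 1 \<le> t \<and> t \<le> n}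
    \<union> {c t u | t u. 1 \<le> t \<and> t < u \<and> u \<le> n}"
  have up: "{vt m t, vt m (Suc t)} \<in> ?R" if "m \<in> C" "t < k" for m t
  proof -
    obtain x where "x \<le> n" "m = s x" using idx \<open>m \<in> C\<close> by blast
    moreover have "t < length m" using V(3) that by (meson less_le_trans)
    then have "{vt m t, vt m (Suc t)} \<in> edges_up_to G r k m"
      using edges_up_to_stem[OF CS[OF \<open>m \<in> C\<close>], of k] that by auto
    ultimately show ?thesis by blast
  qed
  have balk: "{vt m t, vt m' t} \<in> ?R" if mm: "m \<in> C" "balk_at m m' t" for m m' t
  proof -
    have m': "m' \<in> C" "m \<noteq> m'" "t = (if m = h \<or> m' = h then k else l)" using balk_at[OF mm(1)] mm(2) by auto
    obtain x y where xy: "x \<le> n" "m = s x" "y \<le> n" "m' = s y" using idx mm m' by meson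
    then have "x \<noteq> y" using m' by blast
    consider "x = 0" | "y = 0" | "0 < x" "x < y" | "0 < y" "y < x" using \<open>x \<noteq> y\<close> by linarith
    then show ?thesis
    proof cases
      case 1
      then have "{vt m t, vt m' t} = b y" "1 \<le> y" using xy m' s0 \<open>x \<noteq> y\<close> by (auto simp: b_def)
      then show ?thesis using xy by blast
    next
      case 2
      then have "{vt m t, vt m' t} = b x" "1 \<le> x" using xy m' s0 \<open>x \<noteq> y\<close> by (auto simp: b_def insert_commute)
      then show ?thesis using xy by blast
    next
      case 3
      then have "{vt m t, vt m' t} = c x y" using xy m' sh[of x] sh[of y] by (auto simp: c_def)
      then show ?thesis using xy 3 by (intro UnI2 CollectI exI[of _ x] exI[of _ y]) simp
    next
      case 4
      then have "{vt m t, vt m' t} = c y x" using xy m' sh[of x] sh[of y] by (auto simp: c_def insert_commute)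
      then show ?thesis using xy 4 by (intro UnI2 CollectI exI[of _ y] exI[of _ x]) simp
    qed
  qed
  \<comment> \<open>A block is induced, so its edges are all edges of \<open>G\<close> between its
    vertices, and \<open>neighbour_cases\<close> sorts them into stem edges and balks.\<close>
  have "edges B = ?R"
  proof
    show "edges B \<subseteq> ?R"
    proof
      fix e assume "e \<in> edges B"
      then obtain u v where e: "e = {u, v}" "(u, v) \<in> parcs B" by (auto simp: edges_def)
      then obtain m t m' t' where mt: "m \<in> C" "t \<le> k" "u = vt m t" "m' \<in> C" "t' \<le> k" "v = vt m' t'"
        using pB(2) unfolding V(1) by blast
      have G: "(vt m t, v) \<in> parcs G" using e mt pB by auto
      have lens: "t \<le> length m" "t' \<le> length m'" using mt V(3) by (meson le_trans)+
      show "e \<in> ?R"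
      proof (cases "t = 0")
        \<comment> \<open>An edge at the root may enter any stem, so here the coordinates of
          \<open>v\<close> decide instead of those of \<open>u\<close>.\<close>
        case True
        then have u: "u = r" using mt stem_start CS by simp
        then have "(r, v) \<in> parcs G" "{s. stem T r s} \<noteq> {}" using G mt CS by auto
        then obtain m'' where m'': "stem T r m''" "1 \<le> length m''" "v = vt m'' 1"
          using root_neighbour[of v] by auto
        have "vt m'' 1 = vt m' t'" using m''(3) mt(6) by simp
        then have "t' = 1" "m' = m''" using vt_eq_iff[OF m''(1) CS[OF mt(4)] m''(2) lens(2)] by auto
        then have "e = {vt m' 0, vt m' (Suc 0)}" using e u m'' stem_start[of m'] by auto
        then show ?thesis using up[OF mt(4), of 0] V(2) by simp
      next
        case False
        then have "m \<in> {s. stem T r s}" "0 < t" using mt CS by auto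
        from no this lens(1) G show ?thesis
        proof (cases rule: neighbour_cases)
          case down
          then have "e = {vt m (t - 1), vt m (Suc (t - 1))}" using e mt \<open>0 < t\<close> by auto
          then show ?thesis using up[OF mt(1), of "t - 1"] mt \<open>0 < t\<close> by simp
        next
          case up': up
          then have "vt m (Suc t) = vt m' t'" using mt(6) by simp
          then have "t' = Suc t"
            using vt_eq_iff[OF CS[OF mt(1)] CS[OF mt(4)], of "Suc t" t'] lens up'(1) by simp
          then show ?thesis using up[OF mt(1), of t] mt e up' by simp
        next
          case balk': (balk m\<^sub>1)
          then show ?thesis using balk[OF mt(1) balk'(1)] e mt(3) by simp
        qed
      qed
    qed
    have in_B: "{u, v} \<in> edges B" if "u \<in> pverts B" "v \<in> pverts B" "(u, v) \<in> parcs G" for u v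
      using G.block_induced[OF B that(3,1,2)] by (auto simp: edges_def)
    have vB: "vt (s t) d \<in> pverts B" if "t \<le> n" "d \<le> k" for t d
      unfolding V(1) using that sC by blast
    show "?R \<subseteq> edges B"
    proof
      fix e assume "e \<in> ?R"
      then consider t where "t \<le> n" "e \<in> edges_up_to G r k (s t)" | t where "1 \<le> t" "t \<le> n" "e = b t"
        | t u where "1 \<le> t" "t < u" "u \<le> n" "e = c t u" by blast
      then show "e \<in> edges B"
      proof cases
        case (1 t)
        then obtain d where d: "d < k" "d < length (s t)" "e = {vt (s t) d, vt (s t) (Suc d)}"
          unfolding edges_up_to_stem[OF CS[OF sC[OF 1(1)]]] by auto
        then show ?thesis using in_B[OF vB[OF 1(1), of d] vB[OF 1(1), of "Suc d"]]
            stem_edge[of "s t" d] CS sC 1 by auto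
      next
        case (2 t)
        then have "balk_at h (s t) k" using b[of t] balk_between_iff[OF CS[OF hC] CS[OF sC[of t]]] s0 by auto
        then show ?thesis using in_B[OF vB[of 0 k] vB[of t k]] 2 s0 unfolding b_def by (auto simp: balk_at_def)
      next
        case (3 t u)
        then have "balk_at (s t) (s u) l" using c[of t u] balk_between_iff[OF CS[OF sC[of t]] CS[OF sC[of u]]] by auto
        then show ?thesis using in_B[OF vB[of t l] vB[of u l]] 3 lk unfolding c_def by (auto simp: balk_at_def)
      qed
    qed
  qed
  note edges = this
  have stems: "\<forall>t \<le> n. stem T r (s t)" using CS sC by blast
  have verts: "pverts B \<subseteq> (\<Union>t \<le> n. set (pawalk_verts r (s t)))"
    unfolding V(1) C set_stem_verts using V(3) C by force
  have cards: "\<forall>t \<le> n. card (edges_up_to G r k (s t)) = k"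
    using card_edges_up_to_stem[OF CS[OF sC]] V(3) sC by auto
  show ?thesis
    unfolding transversal_def
  proof (intro conjI disjI2)
    show "pair_graph B" "subgraph B G" using block_graph[OF B] by auto
  qed (rule exI[of _ n], rule exI[of _ s], rule exI[of _ l], rule exI[of _ k], rule exI[of _ b],
      rule exI[of _ c], use stems lk verts cards b c edges in blast)
qed

lemma transversal_if_starry:
  assumes "starry" "block G B"
  shows "transversal G r T B"
proof (cases "\<exists>i j a. balk_at i j a \<and> (vt i a, vt j a) \<in> parcs B")
  case True
  then obtain i j a where b: "balk_at i j a" "(vt i a, vt j a) \<in> parcs B" by blast
  obtain C h k l where "i \<in> C" "star C h k l" by (rule starry_star[OF assms(1) b(1)])
  then show ?thesis using transversal_if_balk assms b unfolding starry_def by blast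
next
  case False
  then show ?thesis using transversal_if_no_balk assms unfolding starry_def by blast
qed

section \<open>Transversal blocks force stars\<close>

lemma cross_edge_not_path_edge:
  assumes "stem T r i" "stem T r j" "i \<noteq> j" "0 < a" "a \<le> length i" "0 < b" "b \<le> length j" "stem T r s"
  shows "{vt i a, vt j b} \<notin> path_edges s"
proof
  assume "{vt i a, vt j b} \<in> path_edges s"
  then obtain c where c: "c < length s" "{vt i a, vt j b} = {vt s c, vt s (Suc c)}"
    unfolding path_edges_stem[OF assms(8)] by blast
  then have "i = s" "j = s"
    using vt_eq_iff[of i s a] vt_eq_iff[of j s b] assms by (auto simp: doubleton_eq_iff)
  then show False using assms(3) by simp
qed

lemma balk_edge_eqD:
  assumes "balk_at i j a" "balk_at i' j' a'" "{vt i a, vt j a} = {vt i' a', vt j' a'}"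
  shows "a = a' \<and> (i = i' \<and> j = j' \<or> i = j' \<and> j = i')"
proof -
  have h: "stem T r i" "stem T r j" "stem T r i'" "stem T r j'" "0 < a" "a \<le> length i" "a \<le> length j"
    "a' \<le> length i'" "a' \<le> length j'"
    using assms balk_at_pos by (auto simp: balk_at_def)
  from assms(3) consider "vt i a = vt i' a'" "vt j a = vt j' a'" | "vt i a = vt j' a'" "vt j a = vt i' a'"
    by (auto simp: doubleton_eq_iff)
  then show ?thesis
  proof cases
    case 1
    then show ?thesis using vt_eq_iff[of i i' a a'] vt_eq_iff[of j j' a a'] h by simp
  next
    case 2
    then show ?thesis using vt_eq_iff[of i j' a a'] vt_eq_iff[of j i' a a'] h by simp
  qed
qed

lemma arc_in_block:
  assumes "(u, v) \<in> parcs G"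
  obtains B where "block G B" "(u, v) \<in> parcs B" "u \<in> pverts B" "v \<in> pverts B"
  using G.ex_block_containing[OF G.piece_edge[OF assms]] that by auto

text \<open>The second alternative of \<open>transversal\<close> under a name. The first alternative
  is ruled out by any edge of the block that lies on no stem.\<close>

definition star_presentation ::
    "'a pair_pre_digraph \<Rightarrow> nat \<Rightarrow> (nat \<Rightarrow> ('a \<times> 'a) awalk) \<Rightarrow> nat \<Rightarrow> nat \<Rightarrow> (nat \<Rightarrow> 'a set)
      \<Rightarrow> (nat \<Rightarrow> nat \<Rightarrow> 'a set) \<Rightarrow> bool" where
  "star_presentation B n s l k b c \<longleftrightarrow>
     (\<forall>t \<le> n. stem T r (s t)) \<and> l \<le> k \<and>
     pverts B \<subseteq> (\<Union>t \<le> n. set (pawalk_verts r (s t))) \<and>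
     (\<forall>t \<le> n. card (edges_up_to G r k (s t)) = k) \<and>
     (\<forall>t \<in> {1..n}. balk_between G r k (s 0) (s t) (b t)) \<and>
     (\<forall>t u. 1 \<le> t \<and> t < u \<and> u \<le> n \<longrightarrow> balk_between G r l (s t) (s u) (c t u)) \<and>
     edges B = (\<Union>t \<le> n. edges_up_to G r k (s t)) \<union> {b t | t. 1 \<le> t \<and> t \<le> n}
       \<union> {c t u | t u. 1 \<le> t \<and> t < u \<and> u \<le> n}"

lemma transversal_iff:
  "transversal G r T B \<longleftrightarrow> pair_graph B \<and> subgraph B G \<and>
     ((connected B \<and> (\<exists>s. stem T r s \<and> pverts B \<subseteq> set (pawalk_verts r s) \<and> edges B \<subseteq> path_edges s)) \<or>
      (\<exists>n s l k b c. star_presentation B n s l k b c))"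
  unfolding transversal_def star_presentation_def by (rule refl)

lemma transversalE:
  assumes "transversal G r T B" "e \<in> edges B" "\<forall>s. stem T r s \<longrightarrow> e \<notin> path_edges s"
  obtains n s l k b c where "star_presentation B n s l k b c"
  using assms unfolding transversal_iff by blast

lemma star_presentationD:
  assumes "star_presentation B n s l k b c"
  shows "\<And>t. t \<le> n \<Longrightarrow> stem T r (s t)" "l \<le> k"
    "pverts B \<subseteq> (\<Union>t \<le> n. set (pawalk_verts r (s t)))" "\<And>t. t \<le> n \<Longrightarrow> k \<le> length (s t)"
    "\<And>t. 1 \<le> t \<Longrightarrow> t \<le> n \<Longrightarrow> balk_at (s 0) (s t) k \<and> b t = {vt (s 0) k, vt (s t) k}"
    "\<And>t u. 1 \<le> t \<Longrightarrow> t < u \<Longrightarrow> u \<le> n \<Longrightarrow> balk_at (s t) (s u) l \<and> c t u = {vt (s t) l, vt (s u) l}"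
    "edges B = (\<Union>t \<le> n. edges_up_to G r k (s t)) \<union> {b t | t. 1 \<le> t \<and> t \<le> n}
       \<union> {c t u | t u. 1 \<le> t \<and> t < u \<and> u \<le> n}"
proof -
  note h = assms[unfolded star_presentation_def]
  note stems = h[THEN conjunct1] and cards = h[THEN conjunct2, THEN conjunct2, THEN conjunct2, THEN conjunct1]
    and hubs = h[THEN conjunct2, THEN conjunct2, THEN conjunct2, THEN conjunct2, THEN conjunct1]
    and rims = h[THEN conjunct2, THEN conjunct2, THEN conjunct2, THEN conjunct2, THEN conjunct2, THEN conjunct1]
  show st: "stem T r (s t)" if "t \<le> n" for t using stems that by simp
  show "l \<le> k" "pverts B \<subseteq> (\<Union>t \<le> n. set (pawalk_verts r (s t)))"
    by (rule h[THEN conjunct2, THEN conjunct1], rule h[THEN conjunct2, THEN conjunct2, THEN conjunct1])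
  show "k \<le> length (s t)" if "t \<le> n" for t
    using cards that card_edges_up_to_stem[OF st[OF that], of k] by (metis min.cobounded2)
  show "balk_at (s 0) (s t) k \<and> b t = {vt (s 0) k, vt (s t) k}" if "1 \<le> t" "t \<le> n" for t
    using hubs that balk_between_iff[OF st st, of 0 t k "b t"] by simp
  show "balk_at (s t) (s u) l \<and> c t u = {vt (s t) l, vt (s u) l}" if "1 \<le> t" "t < u" "u \<le> n" for t u
    using rims that balk_between_iff[OF st st, of t u l "c t u"] by simp
  show "edges B = (\<Union>t \<le> n. edges_up_to G r k (s t)) \<union> {b t | t. 1 \<le> t \<and> t \<le> n}
       \<union> {c t u | t u. 1 \<le> t \<and> t < u \<and> u \<le> n}"
    by (rule h[THEN conjunct2, THEN conjunct2, THEN conjunct2, THEN conjunct2, THEN conjunct2, THEN conjunct2])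
qed

lemma edges_up_to_subset: "edges_up_to G r k s \<subseteq> path_edges s"
  by (auto simp: edges_up_to_def)

lemma star_presentation_balk_edge:
  assumes sp: "star_presentation B n s l k b c" and e: "e \<in> edges B"
    and ne: "\<forall>s. stem T r s \<longrightarrow> e \<notin> path_edges s"
  obtains (hub) t where "1 \<le> t" "t \<le> n" "e = {vt (s 0) k, vt (s t) k}" "balk_at (s 0) (s t) k"
    | (rim) t u where "1 \<le> t" "t < u" "u \<le> n" "e = {vt (s t) l, vt (s u) l}" "balk_at (s t) (s u) l"
proof -
  have "e \<notin> (\<Union>t \<le> n. edges_up_to G r k (s t))"
    using ne star_presentationD(1)[OF sp] edges_up_to_subset by blast
  then consider t where "1 \<le> t" "t \<le> n" "e = b t" | t u where "1 \<le> t" "t < u" "u \<le> n" "e = c t u"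
    using e unfolding star_presentationD(7)[OF sp] by blast
  then show ?thesis
  proof cases
    case (1 t)
    then show ?thesis using hub star_presentationD(5)[OF sp, of t] by simp
  next
    case (2 t u)
    then show ?thesis using rim star_presentationD(6)[OF sp, of t u] by simp
  qed
qed

text \<open>The edge lies in some block. Joining different stems away from the root, it is on no
  stem, so it can only be one of the balks of a star presentation, and these stay within a
  tier.\<close>

lemma no_oblique_if_transversal:
  assumes tr: "\<And>B. block G B \<Longrightarrow> transversal G r T B"
  shows no_oblique
  unfolding no_oblique_def
proof (intro ballI allI impI)
  fix i j a b
  assume h: "i \<in> {s. stem T r s}" "j \<in> {s. stem T r s}" "0 < a" "a \<le> length i" "0 < b" "b \<le> length j"
    "i \<noteq> j" "(vt i a, vt j b) \<in> parcs G"
  obtain B where B: "block G B" "(vt i a, vt j b) \<in> parcs B" using arc_in_block[OF h(8)] .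
  let ?e = "{vt i a, vt j b}"
  have e: "?e \<in> edges B" using B by (auto simp: edges_def)
  have ne: "\<forall>s. stem T r s \<longrightarrow> ?e \<notin> path_edges s"
    using cross_edge_not_path_edge[of i j a b] h by simp
  obtain n s l k b' c where sp: "star_presentation B n s l k b' c"
    using transversalE[OF tr[OF B(1)] e ne] by blast
  have "\<exists>x y d. balk_at x y d \<and> ?e = {vt x d, vt y d}"
    by (rule star_presentation_balk_edge[OF sp e ne]) blast+
  then obtain x y d where d: "balk_at x y d" "?e = {vt x d, vt y d}" by blast
  then have "stem T r x" "stem T r y" "d \<le> length x" "d \<le> length y" by (auto simp: balk_at_def)
  then show "a = b"
    using d(2) vt_eq_iff[of i x a d] vt_eq_iff[of j y b d] vt_eq_iff[of i y a d] vt_eq_iff[of j x b d] h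
    by (auto simp: doubleton_eq_iff)
qed

text \<open>The block of the first edge of \<open>j\<close> contains all balks of \<open>j\<close>,
  hence has a star presentation, whose stems form \<open>C\<close>. No member has a balk leading
  elsewhere, because the block also contains the first edge of each member and with it all balks of
  that member.\<close>

lemma star_if_transversal:
  assumes tr: "\<And>B. block G B \<Longrightarrow> transversal G r T B" and balk_at: "balk_at j m a"
  shows "\<exists>C h k l. j \<in> C \<and> star C h k l"
proof -
  have ne: "\<forall>s. stem T r s \<longrightarrow> {vt i x, vt y x} \<notin> path_edges s" if "balk_at i y x" for i y x
    using cross_edge_not_path_edge[of i y x x] that balk_at_pos[OF that] by (simp add: balk_at_def)
  have j: "stem T r j" "1 \<le> length j" using balk_at balk_at_pos[OF balk_at] by (auto simp: balk_at_def)
  have "(r, vt j 1) \<in> parcs G" using stem_edge[of j 0] stem_start[OF j(1)] j less_le_trans[OF _ j(2), of 0] by simp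
  then obtain B where B: "block G B" "r \<in> pverts B" "vt j 1 \<in> pverts B" by (rule arc_in_block)
  have e: "{vt j a, vt m a} \<in> edges B"
    using block_absorbs_balk_cycle(2)[OF B(1) balk_at B(2,3)] by (auto simp: edges_def)
  have pB: "parcs B \<subseteq> pverts B \<times> pverts B" using block_piece[OF B(1)] unfolding piece_def by blast
  obtain n s l k b c where sp: "star_presentation B n s l k b c"
    using transversalE[OF tr[OF B(1)] e ne[OF balk_at]] by blast
  note st = star_presentationD(1)[OF sp] and lk = star_presentationD(2)[OF sp]
    and verts = star_presentationD(3)[OF sp] and len = star_presentationD(4)[OF sp]
    and b = star_presentationD(5)[OF sp] and c = star_presentationD(6)[OF sp]
    and E = star_presentationD(7)[OF sp]
  define C where "C = s ` {..n}"
  have s0: "s t \<noteq> s 0" if "1 \<le> t" "t \<le> n" for t using b[OF that] by (auto simp: balk_at_def)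
  have balk_edge: "(\<exists>t. 1 \<le> t \<and> t \<le> n \<and> x = k \<and> (i = s 0 \<and> y = s t \<or> i = s t \<and> y = s 0))
      \<or> (\<exists>t u. 1 \<le> t \<and> t < u \<and> u \<le> n \<and> x = l \<and> (i = s t \<and> y = s u \<or> i = s u \<and> y = s t))"
    if "balk_at i y x" "{vt i x, vt y x} \<in> edges B" for i y x
    using sp that(2) ne[OF that(1)]
  proof (cases rule: star_presentation_balk_edge)
    case (hub t)
    then show ?thesis using balk_edge_eqD[OF that(1), of "s 0" "s t" k] by auto
  next
    case (rim t u)
    then show ?thesis using balk_edge_eqD[OF that(1), of "s t" "s u" l] by auto
  qed
  \<comment> \<open>The given balk is among the presented ones, so hub balks exist. Their tier
    \<open>k\<close> is therefore positive, and every presented stem contributes its first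
    edge.\<close>
  have n: "1 \<le> n" using balk_edge[OF balk_at e] by auto
  then have k: "0 < k" using b[of 1] balk_at_pos by blast
  have first: "vt i 1 \<in> pverts B" if "i \<in> C" for i
  proof -
    from that have "i \<in> s ` {..n}" by (simp only: C_def)
    then obtain t where t: "t \<le> n" "i = s t" by auto
    then have "{vt i 0, vt i (Suc 0)} \<in> edges_up_to G r k (s t)"
      using edges_up_to_stem[OF st[OF t(1)], of k] k len[OF t(1)] by auto
    then have "{vt i 0, vt i (Suc 0)} \<in> edges B" using E t by blast
    then show ?thesis using pB by (auto simp: edges_def doubleton_eq_iff)
  qed
  have "j \<in> C"
  proof -
    obtain t d where "t \<le> n" "d \<le> length (s t)" "vt j 1 = vt (s t) d"
      using verts B(3) unfolding set_stem_verts by auto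
    then show ?thesis using vt_eq_iff[OF j(1) st j(2)] by (auto simp: C_def)
  qed
  moreover have "star C (s 0) k l"
    unfolding star_def
  proof (intro conjI ballI allI)
    fix i y x assume i: "i \<in> C"
    show "balk_at i y x \<longleftrightarrow> y \<in> C \<and> i \<noteq> y \<and> x = (if i = s 0 \<or> y = s 0 then k else l)"
    proof
      assume b': "balk_at i y x"
      have "{vt i x, vt y x} \<in> edges B"
        using block_absorbs_balk_cycle(2)[OF B(1) b' B(2) first[OF i]] by (auto simp: edges_def)
      from balk_edge[OF b' this] show "y \<in> C \<and> i \<noteq> y \<and> x = (if i = s 0 \<or> y = s 0 then k else l)"
      proof (elim disjE exE conjE)
        fix t u assume t: "1 \<le> t" "t < u" "u \<le> n" "x = l" "i = s t" "y = s u"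
        then show ?thesis using s0[of t] s0[of u] b' by (auto simp: C_def balk_at_def)
      next
        fix t u assume t: "1 \<le> t" "t < u" "u \<le> n" "x = l" "i = s u" "y = s t"
        then show ?thesis using s0[of t] s0[of u] b' by (auto simp: C_def balk_at_def)
      qed (use b' in \<open>auto simp: C_def balk_at_def\<close>)
    next
      assume y: "y \<in> C \<and> i \<noteq> y \<and> x = (if i = s 0 \<or> y = s 0 then k else l)"
      then obtain t u where tu: "t \<le> n" "i = s t" "u \<le> n" "y = s u" using i by (auto simp: C_def)
      then have "t \<noteq> u" using y by blast
      then consider "t = 0" "1 \<le> u" | "u = 0" "1 \<le> t" | "1 \<le> t" "t < u" | "1 \<le> u" "u < t" by linarith
      then show "balk_at i y x"
      proof cases
        case 1
        then show ?thesis using b[of u] tu y by simp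
      next
        case 2
        then show ?thesis using balk_at_sym[of "s 0" "s t" k] b[of t] tu y by simp
      next
        case 3
        then show ?thesis using c[of t u] s0[of t] s0[of u] tu y by simp
      next
        case 4
        then show ?thesis using balk_at_sym[of "s u" "s t" l] c[of u t] s0[of t] s0[of u] tu y by simp
      qed
    qed
  qed (use st lk in \<open>auto simp: C_def\<close>)
  ultimately show ?thesis by blast
qed

lemma starry_if_transversal:
  assumes "\<And>B. block G B \<Longrightarrow> transversal G r T B"
  shows "starry"
  unfolding starry_def
proof (intro conjI ballI)
  show no_oblique using no_oblique_if_transversal assms .
  fix j assume j: "j \<in> {s. stem T r s}"
  show "\<exists>C h k l. j \<in> C \<and> star C h k l"
  proof (cases "\<exists>m a. balk_at j m a")
    case True
    then show ?thesis using star_if_transversal assms by blast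
  next
    case False
    \<comment> \<open>Without balks the two tiers are vacuous, and 0 is a placeholder for
      both.\<close>
    then have "star {j} j 0 0" using j unfolding star_def by auto
    then show ?thesis by blast
  qed
qed

lemma geodetic_iff_blocks_transversal: "geodetic G \<longleftrightarrow> (\<forall>B. block G B \<longrightarrow> transversal G r T B)"
  using G.geodetic_iff_unique_geodesics[OF conn] unique_geodesics_iff_starry
    starry_if_transversal transversal_if_starry by blast

end

theorem theorem2:
  fixes G T :: "'a pair_pre_digraph" and r :: 'a
  assumes "pair_graph G" and "connected G" and "r \<in> pverts G"
    and "bearing_tree G r T"
    and "\<And>s s'. stem T r s \<Longrightarrow> stem T r s' \<Longrightarrow> s \<noteq> s' \<Longrightarrow>
           set (pawalk_verts r s) \<inter> set (pawalk_verts r s') = {r}"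
  shows "geodetic G \<longleftrightarrow> (\<forall>B. block G B \<longrightarrow> transversal G r T B)"
proof -
  interpret stem_disjoint_bearing_tree G T r
    by (rule stem_disjoint_bearing_tree.intro) (fact assms)+
  show ?thesis by (rule geodetic_iff_blocks_transversal)
qed

end
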